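(* In the setting of the context, $A^*$ is $Q$-polynomial (i.e. $\Delta$ is a path) if and only if all of the following hold: (i) $\Delta$ has a leaf, i.e. some vertex of $\Delta$ is adjacent to at most one other vertex; (ii) there exist $\beta,\gamma^*\in\mathbb F$ such that $\gamma^*=\theta^*_{i-1}-\beta\theta^*_i+\theta^*_{i+1}$ for $1\le i\le d-1$; (iii) with $\beta,\gamma^*$ as in (ii) and with $\theta^*_{-1}:=\gamma^*+\beta\theta^*_0-\theta^*_1$ and $\theta^*_{d+1}:=\gamma^*+\beta\theta^*_d-\theta^*_{d-1}$ (so that the relation in (ii) also holds for $i=0$ and $i=d$), there exist $\gamma,\omega,\eta^*\in\mathbb F$ such that $$a_i(\theta^*_i-\theta^*_{i-1})(\theta^*_i-\theta^*_{i+1})=\gamma\theta^{*2}_i+\omega\theta^*_i+\eta^*\qquad(0\le i\le d);$$ (iv) $\theta^*_i\ne\theta^*_0$ for $1\le i\le d$.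
   Context: Let $\mathbb F$ be a field, $d\ge1$ an integer, $V$ a vector space over $\mathbb F$ of dimension $d+1$, $\mathcal A=\mathrm{End}(V)$ with identity $I$. Let $E^*_0,\dots,E^*_d\in\mathcal A$ satisfy $E^*_iE^*_j=\delta_{i,j}E^*_i$ and $\mathrm{rank}(E^*_i)=1$ for $0\le i,j\le d$. Let $A\in\mathcal A$ satisfy $E^*_iAE^*_j=0$ if $|i-j|>1$ and $E^*_iAE^*_j\neq0$ if $|i-j|=1$. Assume $A$ is multiplicity-free, i.e. has $d+1$ mutually distinct eigenvalues $\theta_0,\dots,\theta_d$ in $\mathbb F$, and let $E_i=\prod_{j\ne i}\frac{A-\theta_jI}{\theta_i-\theta_j}$ be the primitive idempotent of $A$ for $\theta_i$. Let $\theta^*_0,\dots,\theta^*_d\in\mathbb F$ and $A^*=\sum_{i=0}^d\theta^*_iE^*_i$. Define $a_i=\mathrm{tr}(E^*_iA)$ for $0\le i\le d$. Let $\Delta$ be the graph on vertex set $\{0,1,\dots,d\}$ in which $i,j$ are adjacent iff $i\ne j$ and $E_iA^*E_j\neq0$ (this relation is symmetric). $A^*$ is called $Q$-polynomial when $\Delta$ is a path graph (its vertices can be ordered $x_0,\dots,x_d$ so that the edges are exactly $\{x_{k-1},x_k\}$, $1\le k\le d$). *)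

theory Defs
  imports "Jordan_Normal_Form.DL_Rank" "Jordan_Normal_Form.Char_Poly"
begin

definition mat_tr :: "'a::comm_ring_1 mat \<Rightarrow> 'a" where
  "mat_tr M = (\<Sum>i<dim_row M. M $$ (i, i))"

text \<open>Primitive idempotent of A for theta i (eigenvalues theta 0..d):
  product over j <> i of (A - theta j I)/(theta i - theta j), taken in increasing j
  (the factors commute).\<close>
definition prim_idem :: "nat \<Rightarrow> 'a::field mat \<Rightarrow> (nat \<Rightarrow> 'a) \<Rightarrow> nat \<Rightarrow> 'a mat" where
  "prim_idem d A \<theta> i =
     foldr (\<lambda>j M. ((1 / (\<theta> i - \<theta> j)) \<cdot>\<^sub>m (A - \<theta> j \<cdot>\<^sub>m 1\<^sub>m (Suc d))) * M)
       (filter (\<lambda>j. j \<noteq> i) [0..<Suc d]) (1\<^sub>m (Suc d))"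

definition mat_sum_list :: "nat \<Rightarrow> (nat \<Rightarrow> 'a::monoid_add mat) \<Rightarrow> nat list \<Rightarrow> 'a mat" where
  "mat_sum_list n f xs = foldr (\<lambda>i M. f i + M) xs (0\<^sub>m n n)"

definition is_path_graph :: "nat \<Rightarrow> (nat \<Rightarrow> nat \<Rightarrow> bool) \<Rightarrow> bool" where
  "is_path_graph d adj \<longleftrightarrow>
     (\<exists>x. bij_betw x {0..d} {0..d} \<and>
        (\<forall>i\<le>d. \<forall>j\<le>d. adj i j \<longleftrightarrow>
            (\<exists>k. 1 \<le> k \<and> k \<le> d \<and> {i, j} = {x (k - 1), x k})))"

definition has_leaf :: "nat \<Rightarrow> (nat \<Rightarrow> nat \<Rightarrow> bool) \<Rightarrow> bool" where
  "has_leaf d adj \<longleftrightarrow> (\<exists>v\<le>d. card {w. w \<le> d \<and> adj v w} \<le> 1)"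

end

theory Submission
  imports Defs
begin

text \<open>
  Let \<open>U\<close> have columns spanning the images of the \<open>E\<^sup>*\<^sub>i\<close>, let \<open>W\<close> have eigenvectors of \<open>A\<close> as columns,
  and put \<open>X = U\<^sup>-\<^sup>1 W\<close>, \<open>Y = X\<^sup>-\<^sup>1\<close>. Then \<open>B = U\<^sup>-\<^sup>1 A U = X diag(\<theta>) Y\<close> is irreducible tridiagonal and
  \<open>\<Delta>\<close> is the off-diagonal support of \<open>T = W\<^sup>-\<^sup>1 A\<^sup>* W = Y diag(\<theta>\<^sup>*) X\<close>.

  If \<open>\<Delta>\<close> is a path, reorder so that \<open>T\<close> is irreducible tridiagonal as well. The operator
  \<open>A\<^sup>2A\<^sup>*A - AA\<^sup>*A\<^sup>2\<close> is a commutator \<open>[p(A), A\<^sup>*]\<close> where \<open>p\<close> has degree at most 3; comparing entries in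
  positions \<open>(i + 3, i)\<close> gives the recurrence for the \<open>\<theta>\<^sup>*\<^sub>i\<close>. Under this recurrence
  \<open>M = A\<^sup>*\<^sup>2A - \<beta>A\<^sup>*AA\<^sup>* + AA\<^sup>*\<^sup>2 - \<gamma>\<^sup>*(AA\<^sup>* + A\<^sup>*A) - \<rho>A\<close> is diagonal with respect to the \<open>E\<^sup>*\<^sub>i\<close>, with
  entries \<open>a\<^sub>i (\<theta>\<^sup>*\<^sub>i - \<theta>\<^sup>*\<^sub>i\<^sub>-\<^sub>1)(\<theta>\<^sup>*\<^sub>i - \<theta>\<^sup>*\<^sub>i\<^sub>+\<^sub>1)\<close>, and has bandwidth 2 in the eigenbasis of \<open>A\<close>, so it is a
  polynomial of degree at most 2 in \<open>A\<^sup>*\<close>.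

  Conversely, \<open>M = \<gamma>A\<^sup>*\<^sup>2 + \<omega>A\<^sup>* + \<eta>\<^sup>*\<close> forces \<open>\<theta>\<^sub>i + \<theta>\<^sub>j = \<beta>\<theta>\<^sub>l + \<gamma>\<close> whenever \<open>l\<close> is the only common neighbour
  of two non-adjacent vertices \<open>i\<close> and \<open>j\<close>. Hence a path that starts in a leaf has at most one continuation,
  and since \<open>\<Delta>\<close> is connected this path exhausts it.
\<close>

section \<open>Path graphs\<close>

text \<open>The path is grown from the leaf. Vertices already passed have all their neighbours on
  the path, so an edge leaving the visited set, supplied by \<open>conn\<close>, starts at the
  current endpoint. A second continuation is excluded by \<open>unique\<close>, applied with the
  last two vertices as \<open>i\<close> and \<open>l\<close>; at the first vertex the leaf condition
  excludes it.\<close>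

lemma path_graph_greedy:
  assumes sym: "\<And>i j. i \<le> d \<Longrightarrow> j \<le> d \<Longrightarrow> adj i j \<Longrightarrow> adj j i"
    and irrefl: "\<And>i. \<not> adj i i"
    and conn: "\<And>V i j. i \<in> V \<Longrightarrow> i \<le> d \<Longrightarrow> j \<notin> V \<Longrightarrow> j \<le> d \<Longrightarrow>
        \<exists>v w. v \<in> V \<and> v \<le> d \<and> w \<notin> V \<and> w \<le> d \<and> adj v w"
    and leaf: "has_leaf d adj"
    and unique: "\<And>i l j k. i \<le> d \<Longrightarrow> l \<le> d \<Longrightarrow> j \<le> d \<Longrightarrow> k \<le> d \<Longrightarrow> adj i l \<Longrightarrow> adj l j \<Longrightarrow> adj l k \<Longrightarrow>
        i \<noteq> j \<Longrightarrow> i \<noteq> k \<Longrightarrow> \<not> adj i j \<Longrightarrow> \<not> adj i k \<Longrightarrow>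
        (\<And>m. m \<le> d \<Longrightarrow> adj i m \<Longrightarrow> adj m j \<or> adj m k \<Longrightarrow> m = l) \<Longrightarrow> j = k"
  shows "is_path_graph d adj"
proof -
  \<comment> \<open>The endpoint \<open>x k\<close> is left out of the neighbourhood clause, since
    its successor is found only in the next step. The leaf bound is carried along because each step
    yields a new \<open>x\<close>.\<close>
  have "\<exists>x. inj_on x {..k} \<and> x ` {..k} \<subseteq> {..d} \<and> card {w. w \<le> d \<and> adj (x 0) w} \<le> 1 \<and>
      (\<forall>m<k. \<forall>w\<le>d. adj (x m) w \<longleftrightarrow> w = x (Suc m) \<or> (0 < m \<and> w = x (m - 1)))" if "k \<le> d" for k
    using that
  proof (induction k)
    case 0
    from leaf obtain v where "v \<le> d" "card {w. w \<le> d \<and> adj v w} \<le> 1"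
      by (auto simp: has_leaf_def)
    thus ?case by (intro exI[of _ "\<lambda>_. v"]) auto
  next
    case (Suc k)
    then obtain x where inj: "inj_on x {..k}" and ran: "x ` {..k} \<subseteq> {..d}"
      and x0: "card {w. w \<le> d \<and> adj (x 0) w} \<le> 1"
      and nb: "\<And>m w. m < k \<Longrightarrow> w \<le> d \<Longrightarrow>
          adj (x m) w \<longleftrightarrow> w = x (Suc m) \<or> (0 < m \<and> w = x (m - 1))"
      by auto
    have xd: "x m \<le> d" if "m \<le> k" for m using ran that by auto
    have "card (x ` {..k}) < card {..d}"
      using card_image[OF inj] Suc.prems by simp
    hence "x ` {..k} \<noteq> {..d}" by auto
    then obtain j where j: "j \<notin> x ` {..k}" "j \<le> d" using ran by auto
    obtain v w where vw: "v \<in> x ` {..k}" "v \<le> d" "w \<notin> x ` {..k}" "w \<le> d" "adj v w"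
      using conn[of "x 0" "x ` {..k}" j] j xd[of 0] by auto
    then obtain m where m: "v = x m" "m \<le> k" by auto
    have "m = k"
    proof (rule ccontr)
      assume "m \<noteq> k"
      hence "w = x (Suc m) \<or> w = x (m - 1)" "Suc m \<le> k" "m - 1 \<le> k" using nb[of m w] m vw by auto
      thus False using vw(3) by auto
    qed
    hence kw: "adj (x k) w" using vw m by simp
    have inner: "m < k \<Longrightarrow> \<not> adj (x m) w'" if "w' \<notin> x ` {..k}" "w' \<le> d" for m w'
      using nb[of m w'] that by auto
    have uniq: "w' = w" if w': "w' \<notin> x ` {..k}" "w' \<le> d" "adj (x k) w'" for w'
    proof (cases k)
      case 0
      have "\<forall>u\<in>{w. w \<le> d \<and> adj (x 0) w}. \<forall>v\<in>{w. w \<le> d \<and> adj (x 0) w}. u = v"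
        using x0 by (subst card_le_Suc0_iff_eq[symmetric]) simp_all
      thus ?thesis using w'(2) w'(3)[unfolded 0] kw[unfolded 0] vw(4) by blast
    next
      case k: (Suc n)
      have n: "n < k" using k by simp
      \<comment> \<open>A common neighbour of \<open>x n\<close> and an unvisited vertex must be the
        endpoint: the other neighbour \<open>x (n - 1)\<close> is an inner vertex and sees only
        visited ones.\<close>
      have mm: "m = x k" if m: "m \<le> d" "adj (x n) m" "adj m w' \<or> adj m w" for m
      proof -
        have "m = x k \<or> (0 < n \<and> m = x (n - 1))" using nb[OF n m(1)] m k by auto
        moreover have "n - 1 < k" using n by simp
        ultimately show ?thesis using inner[OF w'(1,2)] inner[OF vw(3,4)] m(3) by blast
      qed
      have "adj (x n) (x k)" using nb[OF n, of "x k"] xd[of k] k by auto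
      have away: "\<not> adj (x n) u" "x n \<noteq> u" if "u \<notin> x ` {..k}" "u \<le> d" for u
        using inner[OF that n] that n by auto
      show ?thesis
      proof (rule unique[of "x n" "x k" w' w])
        show "x n \<le> d" "x k \<le> d" using xd n by simp_all
        show "w' \<le> d" "w \<le> d" "adj (x k) w'" "adj (x k) w" "adj (x n) (x k)" by fact+
        show "x n \<noteq> w'" "\<not> adj (x n) w'" using away[OF w'(1,2)] by simp_all
        show "x n \<noteq> w" "\<not> adj (x n) w" using away[OF vw(3,4)] by simp_all
        show "m = x k" if "m \<le> d" "adj (x n) m" "adj m w' \<or> adj m w" for m
          using that by (rule mm)
      qed
    qed
    define y where "y = x(Suc k := w)"
    have y: "y m = x m" if "m \<le> k" for m using that by (simp add: y_def)
    have yk: "y (Suc k) = w" by (simp add: y_def)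
    \<comment> \<open>Earlier vertices have known neighbourhoods, so by symmetry the only visited
      neighbour of the endpoint is its predecessor.\<close>
    have bwd: "w' = x (k - 1) \<and> 0 < k" if w': "w' \<in> x ` {..k}" "adj (x k) w'" for w'
    proof -
      obtain m where m: "w' = x m" "m \<le> k" using w' by auto
      have "m < k" using m w' irrefl by (cases "m = k") auto
      moreover have "adj (x m) (x k)" using sym[of "x k" "x m"] xd w' m by auto
      ultimately have "x k = x (Suc m) \<or> 0 < m \<and> x k = x (m - 1)" using nb[of m "x k"] xd[of k] by auto
      hence "k = Suc m \<or> k = m - 1" using inj_onD[OF inj, of k] \<open>m < k\<close> by auto
      thus ?thesis using \<open>m < k\<close> m by auto
    qed
    have prev: "adj (x k) (x (k - 1))" if "0 < k"
      using nb[of "k - 1" "x k"] that xd[of k] xd[of "k - 1"] sym by auto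
    have "adj (x k) w' \<longleftrightarrow> w' = w \<or> (0 < k \<and> w' = x (k - 1))" if "w' \<le> d" for w'
      using uniq[of w'] bwd[of w'] prev kw that by auto
    hence "adj (y m) w' \<longleftrightarrow> w' = y (Suc m) \<or> (0 < m \<and> w' = y (m - 1))" if "m < Suc k" "w' \<le> d" for m w'
      using nb[of m w'] y yk that by (cases "m = k") auto
    moreover have "inj_on y {..Suc k}"
    proof -
      have "inj_on y {..k}" using inj y by (simp add: inj_on_def)
      moreover have "y ` {..k} = x ` {..k}" using y by (intro image_cong) auto
      ultimately show ?thesis using vw(3) yk by (auto simp: atMost_Suc)
    qed
    moreover have "y ` {..Suc k} \<subseteq> {..d}"
      using vw(4) xd y yk by (auto simp: le_Suc_eq)
    moreover have "y 0 = x 0" by (rule y) simp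
    ultimately show ?case using x0 by (intro exI[of _ y]) auto
  qed
  from this[of d] obtain x where inj: "inj_on x {..d}" and ran: "x ` {..d} \<subseteq> {..d}"
    and nb: "\<And>m w. m < d \<Longrightarrow> w \<le> d \<Longrightarrow>
          adj (x m) w \<longleftrightarrow> w = x (Suc m) \<or> (0 < m \<and> w = x (m - 1))" by auto
  have surj: "x ` {..d} = {..d}"
    using inj ran by (intro card_subset_eq) (auto simp: card_image)
  have bij: "bij_betw x {0..d} {0..d}"
    using inj surj by (simp add: bij_betw_def atLeast0AtMost)
  have "adj i j \<longleftrightarrow> (\<exists>k. 1 \<le> k \<and> k \<le> d \<and> {i, j} = {x (k - 1), x k})" if ij: "i \<le> d" "j \<le> d" for i j
  proof
    obtain m n where mn: "i = x m" "m \<le> d" "j = x n" "n \<le> d"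
      using surj ij by (metis atMost_iff imageE)
    assume ad: "adj i j"
    hence "adj (x m) (x n)" "adj (x n) (x m)" "m \<noteq> n"
      using mn sym[OF ij] irrefl[of j] by auto
    have eq: "x a = x b \<longleftrightarrow> a = b" if "a \<le> d" "b \<le> d" for a b
      using inj_on_eq_iff[OF inj] that by simp
    \<comment> \<open>The invariant is silent about \<open>x d\<close>, so it is applied to
      whichever of the two distinct indices lies below \<open>d\<close>.\<close>
    have "n = Suc m \<or> m = Suc n"
    proof (cases "m < d")
      case True
      hence "x n = x (Suc m) \<or> (0 < m \<and> x n = x (m - 1))"
        using nb[OF True, of "x n"] \<open>adj (x m) (x n)\<close> mn ij by simp
      hence "n = Suc m \<or> (0 < m \<and> n = m - 1)" using True mn by (simp add: eq)
      thus ?thesis by linarith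
    next
      case False
      hence nd: "n < d" using mn \<open>m \<noteq> n\<close> by linarith
      hence "x m = x (Suc n) \<or> (0 < n \<and> x m = x (n - 1))"
        using nb[OF nd, of "x m"] \<open>adj (x n) (x m)\<close> mn ij by simp
      hence "m = Suc n \<or> (0 < n \<and> m = n - 1)" using nd mn by (simp add: eq)
      thus ?thesis by linarith
    qed
    thus "\<exists>k. 1 \<le> k \<and> k \<le> d \<and> {i, j} = {x (k - 1), x k}"
    proof
      assume "n = Suc m" thus ?thesis using mn by (intro exI[of _ n]) auto
    next
      assume "m = Suc n" thus ?thesis using mn by (intro exI[of _ m]) auto
    qed
  next
    assume "\<exists>k. 1 \<le> k \<and> k \<le> d \<and> {i, j} = {x (k - 1), x k}"
    then obtain k where k: "1 \<le> k" "k \<le> d" "{i, j} = {x (k - 1), x k}" by blast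
    have "{x (k - 1), x k} \<subseteq> {..d}" unfolding k(3)[symmetric] using ij by simp
    hence xk: "x k \<le> d" "x (k - 1) \<le> d" by simp_all
    have "k - 1 < d" "Suc (k - 1) = k" using k(1,2) by simp_all
    hence "adj (x (k - 1)) (x k)" using nb[of "k - 1" "x k"] xk by simp
    moreover from this have "adj (x k) (x (k - 1))" by (rule sym[OF xk(2,1)])
    moreover have "i = x k \<and> j = x (k - 1) \<or> i = x (k - 1) \<and> j = x k"
      using k(3) unfolding doubleton_eq_iff by blast
    ultimately show "adj i j" by blast
  qed
  thus ?thesis unfolding is_path_graph_def using bij by blast
qed

lemma path_graph_has_leaf:
  assumes "is_path_graph d adj"
  shows "has_leaf d adj"
proof -
  obtain x where x: "bij_betw x {0..d} {0..d}"
    and adj: "\<And>i j. i \<le> d \<Longrightarrow> j \<le> d \<Longrightarrow>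
        adj i j \<longleftrightarrow> (\<exists>k. 1 \<le> k \<and> k \<le> d \<and> {i, j} = {x (k - 1), x k})"
    using assms by (auto simp: is_path_graph_def)
  have x0: "x 0 \<le> d" using bij_betwE[OF x] by simp
  have "{w. w \<le> d \<and> adj (x 0) w} \<subseteq> {x 1}"
  proof
    fix w assume "w \<in> {w. w \<le> d \<and> adj (x 0) w}"
    then obtain k where k: "1 \<le> k" "k \<le> d" "{x 0, w} = {x (k - 1), x k}" using adj x0 by auto
    have inj: "x 0 = x l \<Longrightarrow> l \<le> d \<Longrightarrow> l = 0" for l
      using bij_betw_imp_inj_on[OF x] by (auto simp: inj_on_def)
    have "x 0 \<noteq> x k" using inj[of k] k by auto
    hence "x 0 = x (k - 1)" "w = x k" using k(3) by (auto simp: doubleton_eq_iff)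
    have "k - 1 = 0" by (rule inj[OF \<open>x 0 = x (k - 1)\<close>]) (use k in simp)
    hence "k = 1" using k(1) by simp
    thus "w \<in> {x 1}" using \<open>w = x k\<close> by simp
  qed
  hence "card {w. w \<le> d \<and> adj (x 0) w} \<le> card {x 1}" by (intro card_mono) auto
  thus ?thesis unfolding has_leaf_def using x0 by auto
qed

section \<open>Irreducible tridiagonal matrices\<close>

text \<open>Encoding matrices as functions makes a permutation of the basis a mere
  composition.\<close>

definition tridiag :: "nat \<Rightarrow> (nat \<Rightarrow> nat \<Rightarrow> 'a::zero) \<Rightarrow> bool" where
  "tridiag d B \<longleftrightarrow>
     (\<forall>i\<le>d. \<forall>j\<le>d. (i + 1 < j \<or> j + 1 < i \<longrightarrow> B i j = 0) \<and>
                  (i + 1 = j \<or> j + 1 = i \<longrightarrow> B i j \<noteq> 0))"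

lemma tridiag_far: "tridiag d B \<Longrightarrow> i \<le> d \<Longrightarrow> j \<le> d \<Longrightarrow> i + 1 < j \<or> j + 1 < i \<Longrightarrow> B i j = 0"
  by (auto simp: tridiag_def)

lemma tridiag_near: "tridiag d B \<Longrightarrow> i \<le> d \<Longrightarrow> j \<le> d \<Longrightarrow> i + 1 = j \<or> j + 1 = i \<Longrightarrow> B i j \<noteq> 0"
  by (auto simp: tridiag_def)

lemma sum_atMost_delta:
  fixes f :: "nat \<Rightarrow> 'a::semiring_1"
  assumes "i \<le> d"
  shows "(\<Sum>k\<le>d. (if i = k then 1 else 0) * f k) = f i"
    and "(\<Sum>k\<le>d. (if k = i then 1 else 0) * f k) = f i"
    and "(\<Sum>k\<le>d. f k * (if i = k then 1 else 0)) = f i"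
    and "(\<Sum>k\<le>d. f k * (if k = i then 1 else 0)) = f i"
proof -
  have *: "(\<Sum>k\<le>d. if i = k then f k else 0) = f i" "(\<Sum>k\<le>d. if k = i then f k else 0) = f i"
    using assms by simp_all
  show "(\<Sum>k\<le>d. (if i = k then 1 else 0) * f k) = f i"
    by (subst *(1)[symmetric], rule sum.cong) auto
  show "(\<Sum>k\<le>d. (if k = i then 1 else 0) * f k) = f i"
    by (subst *(1)[symmetric], rule sum.cong) auto
  show "(\<Sum>k\<le>d. f k * (if i = k then 1 else 0)) = f i"
    by (subst *(1)[symmetric], rule sum.cong) auto
  show "(\<Sum>k\<le>d. f k * (if k = i then 1 else 0)) = f i"
    by (subst *(1)[symmetric], rule sum.cong) auto
qed

text \<open>Associativity of row vector, \<open>X\<close>, diagonal matrix, \<open>Y\<close>, column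
  vector, grouped so that the middle three factors can be replaced by an entry of
  \<open>B\<close>.\<close>

lemma sum_triple_product:
  fixes a b t :: "nat \<Rightarrow> 'a::comm_semiring_0"
  shows "(\<Sum>l\<le>d. (\<Sum>k\<le>d. a k * X k l) * t l * (\<Sum>m\<le>d. Y l m * b m))
       = (\<Sum>k\<le>d. \<Sum>m\<le>d. a k * (\<Sum>l\<le>d. X k l * t l * Y l m) * b m)"
proof -
  have "(\<Sum>l\<le>d. (\<Sum>k\<le>d. a k * X k l) * t l * (\<Sum>m\<le>d. Y l m * b m))
      = (\<Sum>l\<le>d. \<Sum>k\<le>d. \<Sum>m\<le>d. a k * (X k l * t l * Y l m) * b m)"
    by (simp add: sum_product sum_distrib_right sum_distrib_left ac_simps)
  also have "\<dots> = (\<Sum>k\<le>d. \<Sum>l\<le>d. \<Sum>m\<le>d. a k * (X k l * t l * Y l m) * b m)"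
    by (rule sum.swap)
  also have "\<dots> = (\<Sum>k\<le>d. \<Sum>m\<le>d. \<Sum>l\<le>d. a k * (X k l * t l * Y l m) * b m)"
    by (intro sum.cong refl sum.swap)
  finally show ?thesis by (simp add: sum_distrib_left sum_distrib_right)
qed

text \<open>Column \<open>i\<close> of \<open>B\<close> is supported in rows \<open>i - 1\<close>,
  \<open>i\<close>, \<open>i + 1\<close>, so the eigenvector equation there determines the next
  component. At \<open>i = 0\<close> the truncated index \<open>i - 1\<close> has to be
  excluded.\<close>

lemma tridiag_left_eigenvector_step:
  fixes B :: "nat \<Rightarrow> nat \<Rightarrow> 'a::field"
  assumes tri: "tridiag d B" and i: "Suc i \<le> d"
    and ev: "(\<Sum>j\<le>d. y j * B j i) = t * y i"
  shows "y (Suc i) * B (Suc i) i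
       = (t - B i i) * y i - (if i = 0 then 0 else y (i - 1) * B (i - 1) i)"
proof -
  let ?N = "(if i = 0 then {} else {i - 1}) \<union> {i, Suc i}"
  have "(\<Sum>j\<le>d. y j * B j i) = (\<Sum>j\<in>?N. y j * B j i)"
  proof (rule sum.mono_neutral_right)
    show "\<forall>j\<in>{..d} - ?N. y j * B j i = 0"
    proof
      fix j assume j: "j \<in> {..d} - ?N"
      hence "i + 1 < j \<or> j + 1 < i" by (auto split: if_splits)
      thus "y j * B j i = 0" using tridiag_far[OF tri, of j i] i j by auto
    qed
  qed (use i in auto)
  also have "\<dots> = (if i = 0 then 0 else y (i - 1) * B (i - 1) i) + y i * B i i + y (Suc i) * B (Suc i) i"
    by (auto simp: algebra_simps)
  finally show ?thesis using ev by (simp add: algebra_simps split: if_splits)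
qed

text \<open>The three-term recurrence builds one polynomial for all left eigenvectors:
  \<open>p\<close> is chosen before \<open>t\<close> and \<open>y\<close>, so different eigenvectors
  can be compared.\<close>

lemma tridiag_left_eigenvector_poly:
  fixes B :: "nat \<Rightarrow> nat \<Rightarrow> 'a::field"
  assumes tri: "tridiag d B"
  shows "i \<le> d \<Longrightarrow> \<exists>p. degree p \<le> i \<and>
    (\<forall>t y. (\<forall>k\<le>d. (\<Sum>j\<le>d. y j * B j k) = t * y k) \<longrightarrow> y i = poly p t * y 0)"
proof (induction i rule: less_induct)
  case (less i)
  show ?case
  proof (cases i)
    case 0
    thus ?thesis by (intro exI[of _ 1]) auto
  next
    case (Suc n)
    have nz: "B (Suc n) n \<noteq> 0" using tridiag_near[OF tri] less.prems Suc by auto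
    have n1: "n < i" "n \<le> d" "n - 1 < i" "n - 1 \<le> d" using less.prems Suc by auto
    obtain p where p: "degree p \<le> n \<and>
        (\<forall>t y. (\<forall>k\<le>d. (\<Sum>j\<le>d. y j * B j k) = t * y k) \<longrightarrow> y n = poly p t * y 0)"
      using less.IH[OF n1(1,2)] by (rule exE)
    \<comment> \<open>For \<open>n = 0\<close> the truncated index \<open>n - 1\<close> repeats
      \<open>n\<close>; the conditional in \<open>r\<close> then discards \<open>q\<close>.\<close>
    obtain q where q: "degree q \<le> n - 1 \<and>
        (\<forall>t y. (\<forall>k\<le>d. (\<Sum>j\<le>d. y j * B j k) = t * y k) \<longrightarrow> y (n - 1) = poly q t * y 0)"
      using less.IH[OF n1(3,4)] by (rule exE)
    define r where "r = smult (1 / B (Suc n) n)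
        ([:- B n n, 1:] * p - (if n = 0 then 0 else smult (B (n - 1) n) q))"
    have "degree ([:- B n n, 1:] * p) \<le> Suc n"
      using degree_mult_le[of "[:- B n n, 1:]" p] conjunct1[OF p] by simp
    moreover have "degree (if n = 0 then 0 else smult (B (n - 1) n) q) \<le> Suc n"
      using conjunct1[OF q] degree_smult_le[of "B (n - 1) n" q] by (cases "n = 0") simp_all
    ultimately have "degree r \<le> Suc n"
      unfolding r_def by (intro order.trans[OF degree_smult_le] degree_diff_le)
    moreover have "y (Suc n) = poly r t * y 0"
      if y: "\<forall>k\<le>d. (\<Sum>j\<le>d. y j * B j k) = t * y k" for t y
    proof -
      have "y (Suc n) * B (Suc n) n
          = (t - B n n) * y n - (if n = 0 then 0 else y (n - 1) * B (n - 1) n)"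
        using less.prems Suc y[rule_format, of n] by (intro tridiag_left_eigenvector_step[OF tri]) simp_all
      also have "\<dots> = ((t - B n n) * poly p t - (if n = 0 then 0 else poly q t * B (n - 1) n)) * y 0"
        unfolding mp[OF spec[OF spec[OF conjunct2[OF p]]] y] mp[OF spec[OF spec[OF conjunct2[OF q]]] y]
        by (cases "n = 0") (simp_all add: algebra_simps)
      also have "(t - B n n) * poly p t - (if n = 0 then 0 else poly q t * B (n - 1) n)
          = poly r t * B (Suc n) n"
        using nz by (cases "n = 0") (simp_all add: r_def algebra_simps)
      finally have "y (Suc n) * B (Suc n) n = (poly r t * y 0) * B (Suc n) n"
        by (simp only: ac_simps)
      thus ?thesis using nz by simp
    qed
    ultimately show ?thesis using Suc by blast
  qed
qed

text \<open>Multiplying up the ratios of super- to subdiagonal entries gives a diagonal matrix whose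
  product with \<open>B\<close> is symmetric.\<close>

lemma tridiag_symmetrizer:
  fixes B :: "nat \<Rightarrow> nat \<Rightarrow> 'a::field"
  assumes tri: "tridiag d B"
  shows "\<exists>\<kappa>. (\<forall>i\<le>d. \<kappa> i \<noteq> 0) \<and> (\<forall>i\<le>d. \<forall>j\<le>d. \<kappa> i * B i j = \<kappa> j * B j i)"
proof -
  define \<kappa> where "\<kappa> i = (\<Prod>k<i. B k (Suc k) / B (Suc k) k)" for i
  have near: "B k (Suc k) \<noteq> 0" "B (Suc k) k \<noteq> 0" if "Suc k \<le> d" for k
    using tridiag_near[OF tri, of k "Suc k"] tridiag_near[OF tri, of "Suc k" k] that by auto
  have "\<kappa> i \<noteq> 0" if "i \<le> d" for i
    unfolding \<kappa>_def using near that by (simp add: prod_zero_iff)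
  moreover have step: "\<kappa> i * B i (Suc i) = \<kappa> (Suc i) * B (Suc i) i" if "Suc i \<le> d" for i
    using near[OF that] by (simp add: \<kappa>_def)
  have "\<kappa> i * B i j = \<kappa> j * B j i" if "i \<le> d" "j \<le> d" for i j
  proof -
    consider "i + 1 < j \<or> j + 1 < i" | "i = j" | "j = Suc i" | "i = Suc j" by linarith
    thus ?thesis
    proof cases
      case 1
      thus ?thesis using tridiag_far[OF tri, of i j] tridiag_far[OF tri, of j i] that by auto
    next
      case 3 thus ?thesis using step[of i] that by simp
    next
      case 4 thus ?thesis using step[of j] that by simp
    qed simp
  qed
  ultimately show ?thesis by blast
qed

text \<open>Lower bandwidths add under multiplication, and on the extreme diagonal of the product a
  single summand survives.\<close>

lemma sum_lower_band:
  fixes F G :: "nat \<Rightarrow> nat \<Rightarrow> 'a::semiring_0"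
  assumes F: "\<And>l. l \<le> d \<Longrightarrow> l + r < i \<Longrightarrow> F i l = 0"
    and G: "\<And>l. l \<le> d \<Longrightarrow> j + s < l \<Longrightarrow> G l j = 0"
    and i: "i \<le> d"
  shows "i > j + r + s \<Longrightarrow> (\<Sum>l\<le>d. F i l * G l j) = 0"
    and "i = j + r + s \<Longrightarrow> (\<Sum>l\<le>d. F i l * G l j) = F i (j + s) * G (j + s) j"
proof -
  assume gt: "i > j + r + s"
  show "(\<Sum>l\<le>d. F i l * G l j) = 0"
  proof (rule sum.neutral, rule ballI)
    fix l assume l: "l \<in> {..d}"
    show "F i l * G l j = 0"
      using F[of l] G[of l] l gt by (cases "l + r < i") simp_all
  qed
next
  assume eq: "i = j + r + s"
  have "F i l * G l j = 0" if "l \<le> d" "l \<noteq> j + s" for l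
    using F[of l] G[of l] that eq by (cases "l + r < i") simp_all
  hence "(\<Sum>l\<le>d. F i l * G l j) = (\<Sum>l\<in>{j + s}. F i l * G l j)"
    using eq i by (intro sum.mono_neutral_right) auto
  thus "(\<Sum>l\<le>d. F i l * G l j) = F i (j + s) * G (j + s) j" by simp
qed

lemma path_graph_tridiag:
  assumes "is_path_graph d (\<lambda>i j. i \<noteq> j \<and> T i j \<noteq> 0)"
  shows "\<exists>x. bij_betw x {..d} {..d} \<and> tridiag d (\<lambda>i j. T (x i) (x j))"
proof -
  obtain x where x: "bij_betw x {..d} {..d}"
    and adj: "\<And>i j. i \<le> d \<Longrightarrow> j \<le> d \<Longrightarrow>
        (i \<noteq> j \<and> T i j \<noteq> 0) \<longleftrightarrow> (\<exists>k. 1 \<le> k \<and> k \<le> d \<and> {i, j} = {x (k - 1), x k})"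
    using assms by (auto simp: is_path_graph_def atLeast0AtMost)
  have inj: "x i = x j \<longleftrightarrow> i = j" if "i \<le> d" "j \<le> d" for i j
    using bij_betw_imp_inj_on[OF x] that by (auto simp: inj_on_def)
  have key: "(x i \<noteq> x j \<and> T (x i) (x j) \<noteq> 0) \<longleftrightarrow> i + 1 = j \<or> j + 1 = i" if ij: "i \<le> d" "j \<le> d" for i j
  proof -
    have "x i \<le> d" "x j \<le> d" using bij_betwE[OF x] ij by auto
    hence "(x i \<noteq> x j \<and> T (x i) (x j) \<noteq> 0)
        \<longleftrightarrow> (\<exists>k. 1 \<le> k \<and> k \<le> d \<and> {x i, x j} = {x (k - 1), x k})" by (rule adj)
    also have "\<dots> \<longleftrightarrow> (\<exists>k. 1 \<le> k \<and> k \<le> d \<and> {i, j} = {k - 1, k})"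
      using ij by (auto simp: doubleton_eq_iff inj)
    also have "\<dots> \<longleftrightarrow> i + 1 = j \<or> j + 1 = i"
      using ij by (auto simp: doubleton_eq_iff)
    finally show ?thesis .
  qed
  have "tridiag d (\<lambda>i j. T (x i) (x j))"
    unfolding tridiag_def
  proof (intro allI impI)
    fix i j assume "i \<le> d" "j \<le> d"
    thus "(i + 1 < j \<or> j + 1 < i \<longrightarrow> T (x i) (x j) = 0) \<and>
        (i + 1 = j \<or> j + 1 = i \<longrightarrow> T (x i) (x j) \<noteq> 0)"
      using key[of i j] inj[of i j] by auto
  qed
  thus ?thesis using x by blast
qed

section \<open>Three-term recurrences\<close>

lemma poly_sum_of_degree_le:
  fixes p :: "'a::comm_semiring_1 poly"
  assumes "degree p \<le> n"
  shows "poly p x = (\<Sum>i\<le>n. coeff p i * x ^ i)"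
  unfolding poly_altdef using assms
  by (intro sum.mono_neutral_left) (auto simp: coeff_eq_0)

locale recurrent =
  fixes d :: nat and \<theta>s :: "nat \<Rightarrow> 'a::field" and \<beta> \<gamma>s :: 'a
  assumes d: "1 \<le> d"
    and rec: "\<And>i. 1 \<le> i \<Longrightarrow> i \<le> d - 1 \<Longrightarrow> \<gamma>s = \<theta>s (i - 1) - \<beta> * \<theta>s i + \<theta>s (i + 1)"
begin

text \<open>\<open>prv\<close> and \<open>nxt\<close> extend the sequence by fictitious values at
  \<open>-1\<close> and \<open>d + 1\<close>, chosen so that the recurrence persists at both
  ends.\<close>

definition prv where "prv i = (if i = 0 then \<gamma>s + \<beta> * \<theta>s 0 - \<theta>s 1 else \<theta>s (i - 1))"
definition nxt where "nxt i = (if i = d then \<gamma>s + \<beta> * \<theta>s d - \<theta>s (d - 1) else \<theta>s (i + 1))"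

definition \<rho> where "\<rho> = (\<theta>s 0)^2 - \<beta> * \<theta>s 0 * \<theta>s 1 + (\<theta>s 1)^2 - \<gamma>s * (\<theta>s 0 + \<theta>s 1)"

text \<open>Successive values differ by \<open>\<theta>s (i + 2) - \<theta>s i\<close> times the
  defect of the recurrence, which is zero.\<close>

lemma \<rho>_invariant:
  "Suc i \<le> d \<Longrightarrow>
    (\<theta>s i)^2 - \<beta> * \<theta>s i * \<theta>s (Suc i) + (\<theta>s (Suc i))^2 - \<gamma>s * (\<theta>s i + \<theta>s (Suc i)) = \<rho>"
proof (induction i)
  case 0
  show ?case by (simp add: \<rho>_def)
next
  case (Suc i)
  have r: "\<theta>s i - \<beta> * \<theta>s (Suc i) + \<theta>s (Suc (Suc i)) = \<gamma>s"
    using rec[of "Suc i"] Suc.prems by simp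
  have "(\<theta>s (Suc i))^2 - \<beta> * \<theta>s (Suc i) * \<theta>s (Suc (Suc i)) + (\<theta>s (Suc (Suc i)))^2
        - \<gamma>s * (\<theta>s (Suc i) + \<theta>s (Suc (Suc i)))
      = (\<theta>s i)^2 - \<beta> * \<theta>s i * \<theta>s (Suc i) + (\<theta>s (Suc i))^2 - \<gamma>s * (\<theta>s i + \<theta>s (Suc i))"
    unfolding r[symmetric] by (simp add: algebra_simps power2_eq_square)
  thus ?case using Suc by simp
qed

text \<open>Replace the first argument \<open>\<theta>s i\<close> of the conserved expression by a
  variable. The resulting monic quadratic has roots \<open>prv i\<close> and \<open>nxt i\<close>:
  one by invariance of \<open>\<rho>\<close>, the other because the sum of the roots is
  \<open>\<gamma>s + \<beta> * \<theta>s i\<close>. It is evaluated at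
  \<open>\<theta>s i\<close>.\<close>

lemma diagonal:
  assumes "i \<le> d"
  shows "(\<theta>s i)^2 - \<beta> * \<theta>s i * \<theta>s i + (\<theta>s i)^2 - \<gamma>s * (\<theta>s i + \<theta>s i) - \<rho>
    = (\<theta>s i - prv i) * (\<theta>s i - nxt i)"
proof (cases i)
  case 0
  have "nxt 0 = \<theta>s 1" using d by (simp add: nxt_def)
  thus ?thesis unfolding 0 \<rho>_def prv_def by (simp add: algebra_simps power2_eq_square)
next
  case (Suc k)
  have p: "prv i = \<theta>s k" by (simp add: prv_def Suc)
  have n: "nxt i = \<gamma>s + \<beta> * \<theta>s i - \<theta>s k"
    using rec[of i] assms Suc by (auto simp: nxt_def)
  have "\<rho> = (\<theta>s k)^2 - \<beta> * \<theta>s k * \<theta>s i + (\<theta>s i)^2 - \<gamma>s * (\<theta>s k + \<theta>s i)"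
    using \<rho>_invariant[of k] assms Suc by simp
  thus ?thesis unfolding p n by (simp add: algebra_simps power2_eq_square)
qed

text \<open>This is entry \<open>(k, m)\<close> of the operator \<open>M\<close> in the basis of the
  \<open>Es i\<close>: far from the diagonal \<open>B\<close> vanishes, next to it invariance of
  \<open>\<rho>\<close> kills the scalar factor, and on it the factor splits.\<close>

lemma tridiag_relation:
  assumes tri: "tridiag d B" and k: "k \<le> d" and m: "m \<le> d"
  shows "B k m * ((\<theta>s k)^2 - \<beta> * \<theta>s k * \<theta>s m + (\<theta>s m)^2 - \<gamma>s * (\<theta>s k + \<theta>s m) - \<rho>)
      = (if k = m then B k k * (\<theta>s k - prv k) * (\<theta>s k - nxt k) else 0)"
proof -
  consider "k + 1 < m \<or> m + 1 < k" | "k = m" | "m = Suc k" | "k = Suc m" by linarith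
  thus ?thesis
  proof cases
    case 1
    thus ?thesis using tridiag_far[OF tri k m] by auto
  next
    case 2
    thus ?thesis using diagonal[OF k] by (simp add: mult.assoc)
  next
    case 3
    thus ?thesis using \<rho>_invariant[of k] m by simp
  next
    case 4
    thus ?thesis using \<rho>_invariant[of m] k by (simp add: algebra_simps)
  qed
qed

end

section \<open>Pairs of matrices with a tridiagonal first member\<close>

text \<open>\<open>X\<close> is the transition matrix between the two bases, \<open>B\<close> is
  \<open>A\<close> in the basis of the \<open>Es i\<close>, and \<open>T\<close> is
  \<open>As\<close> in the eigenbasis of \<open>A\<close>. Tridiagonality is kept out, so that the
  two sides can be exchanged.\<close>

locale diag_pair =
  fixes d :: nat and X Y B T :: "nat \<Rightarrow> nat \<Rightarrow> 'a::field" and \<theta> \<theta>s :: "nat \<Rightarrow> 'a"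
  assumes XY: "\<And>i k. i \<le> d \<Longrightarrow> k \<le> d \<Longrightarrow> (\<Sum>j\<le>d. X i j * Y j k) = (if i = k then 1 else 0)"
    and YX: "\<And>i k. i \<le> d \<Longrightarrow> k \<le> d \<Longrightarrow> (\<Sum>j\<le>d. Y i j * X j k) = (if i = k then 1 else 0)"
    and B_eq: "\<And>i j. i \<le> d \<Longrightarrow> j \<le> d \<Longrightarrow> B i j = (\<Sum>k\<le>d. X i k * \<theta> k * Y k j)"
    and T_eq: "\<And>i j. i \<le> d \<Longrightarrow> j \<le> d \<Longrightarrow> T i j = (\<Sum>k\<le>d. Y i k * \<theta>s k * X k j)"
begin

section \<open>Diagonal operators seen from the other basis\<close>

text \<open>\<open>S p\<close> is, in the eigenbasis of \<open>A\<close>, the operator acting as the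
  scalar \<open>p k\<close> on the image of \<open>Es k\<close>.\<close>

definition S :: "(nat \<Rightarrow> 'a) \<Rightarrow> nat \<Rightarrow> nat \<Rightarrow> 'a" where
  "S p i j = (\<Sum>k\<le>d. Y i k * p k * X k j)"

text \<open>The assumptions are symmetric under exchange of the two bases, so facts about a
  tridiagonal \<open>T\<close> also serve for a tridiagonal \<open>B\<close>.\<close>

lemma dual: "diag_pair d Y X T B \<theta>s \<theta>"
  by standard (use XY YX B_eq T_eq in auto)

lemma T_S: "i \<le> d \<Longrightarrow> j \<le> d \<Longrightarrow> T i j = S \<theta>s i j"
  by (simp add: T_eq S_def)

lemma S_one: "i \<le> d \<Longrightarrow> j \<le> d \<Longrightarrow> S (\<lambda>_. 1) i j = (if i = j then 1 else 0)"
  by (simp add: S_def YX)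

text \<open>The product \<open>p(As) A q(As)\<close> computed twice: the middle factor is diagonal
  in the eigenbasis of \<open>A\<close>, the outer ones in the other basis.\<close>

lemma S_eigen:
  assumes "i \<le> d" "j \<le> d"
  shows "(\<Sum>l\<le>d. S p i l * \<theta> l * S q l j)
       = (\<Sum>k\<le>d. \<Sum>m\<le>d. Y i k * p k * B k m * (q m * X m j))"
  unfolding S_def
  using sum_triple_product[of "\<lambda>k. Y i k * p k" X d \<theta> Y "\<lambda>m. q m * X m j"] B_eq
  by (simp add: mult.assoc)

lemma S_mult:
  assumes "i \<le> d" "j \<le> d"
  shows "(\<Sum>l\<le>d. S p i l * S q l j) = S (\<lambda>k. p k * q k) i j"
proof -
  have "(\<Sum>l\<le>d. S p i l * S q l j)
     = (\<Sum>k\<le>d. \<Sum>m\<le>d. (Y i k * p k) * (\<Sum>l\<le>d. X k l * 1 * Y l m) * (q m * X m j))"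
    unfolding S_def
    using sum_triple_product[of "\<lambda>k. Y i k * p k" X d "\<lambda>_. 1" Y "\<lambda>m. q m * X m j"]
    by (simp add: mult.assoc)
  also have "\<dots> = (\<Sum>k\<le>d. (Y i k * p k) * (q k * X k j))"
  proof (rule sum.cong[OF refl])
    fix k assume k: "k \<in> {..d}"
    have "(\<Sum>m\<le>d. (Y i k * p k) * (\<Sum>l\<le>d. X k l * 1 * Y l m) * (q m * X m j))
        = (\<Sum>m\<le>d. (if k = m then 1 else 0) * ((Y i k * p k) * (q m * X m j)))"
      using k by (intro sum.cong refl) (simp add: XY)
    also have "\<dots> = (Y i k * p k) * (q k * X k j)"
      using k by (intro sum_atMost_delta) simp
    finally show "(\<Sum>m\<le>d. (Y i k * p k) * (\<Sum>l\<le>d. X k l * 1 * Y l m) * (q m * X m j))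
        = (Y i k * p k) * (q k * X k j)" .
  qed
  finally show ?thesis by (simp add: S_def mult.assoc)
qed

lemma T_Y:
  assumes "i \<le> d" "j \<le> d"
  shows "(\<Sum>l\<le>d. T i l * Y l j) = Y i j * \<theta>s j"
proof -
  have "(\<Sum>l\<le>d. T i l * Y l j) = (\<Sum>l\<le>d. \<Sum>k\<le>d. (Y i k * \<theta>s k) * (X k l * Y l j))"
    using assms by (intro sum.cong refl) (simp add: T_eq sum_distrib_right mult.assoc)
  also have "\<dots> = (\<Sum>k\<le>d. \<Sum>l\<le>d. (Y i k * \<theta>s k) * (X k l * Y l j))"
    by (rule sum.swap)
  also have "\<dots> = (\<Sum>k\<le>d. (Y i k * \<theta>s k) * (if k = j then 1 else 0))"
    using assms by (intro sum.cong refl) (simp add: sum_distrib_left[symmetric] XY)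
  also have "\<dots> = Y i j * \<theta>s j" using assms by (intro sum_atMost_delta)
  finally show ?thesis .
qed

lemma X_T:
  assumes "i \<le> d" "j \<le> d"
  shows "(\<Sum>l\<le>d. X i l * T l j) = \<theta>s i * X i j"
proof -
  have "(\<Sum>l\<le>d. X i l * T l j) = (\<Sum>l\<le>d. \<Sum>k\<le>d. (X i l * Y l k) * (\<theta>s k * X k j))"
    using assms by (intro sum.cong refl) (simp add: T_eq sum_distrib_left mult.assoc)
  also have "\<dots> = (\<Sum>k\<le>d. \<Sum>l\<le>d. (X i l * Y l k) * (\<theta>s k * X k j))"
    by (rule sum.swap)
  also have "\<dots> = (\<Sum>k\<le>d. (if i = k then 1 else 0) * (\<theta>s k * X k j))"
    using assms by (intro sum.cong refl) (simp add: sum_distrib_right[symmetric] XY)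
  also have "\<dots> = \<theta>s i * X i j" using assms by (intro sum_atMost_delta)
  finally show ?thesis .
qed

text \<open>The left side is an entry of the commutator of \<open>X diag(z) Y\<close> with
  \<open>diag(\<theta>s)\<close>. Conjugation turns it into the commutator of \<open>diag(z)\<close>
  with \<open>T\<close>.\<close>

lemma commutator:
  assumes "i \<le> d" "j \<le> d"
  shows "(\<Sum>k\<le>d. X i k * z k * Y k j) * (\<theta>s j - \<theta>s i)
       = (\<Sum>k\<le>d. \<Sum>l\<le>d. X i k * ((z k - z l) * T k l) * Y l j)"
proof -
  have "(\<Sum>k\<le>d. X i k * z k * Y k j) * \<theta>s j = (\<Sum>k\<le>d. X i k * z k * (\<Sum>l\<le>d. T k l * Y l j))"
    using assms by (simp add: T_Y sum_distrib_right mult.assoc)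
  also have "\<dots> = (\<Sum>k\<le>d. \<Sum>l\<le>d. X i k * z k * T k l * Y l j)"
    by (simp add: sum_distrib_left mult.assoc)
  finally have 1: "(\<Sum>k\<le>d. X i k * z k * Y k j) * \<theta>s j = (\<Sum>k\<le>d. \<Sum>l\<le>d. X i k * z k * T k l * Y l j)" .
  have "(\<Sum>l\<le>d. X i l * z l * Y l j) * \<theta>s i = (\<Sum>l\<le>d. (\<Sum>k\<le>d. X i k * T k l) * z l * Y l j)"
    unfolding sum_distrib_right[of _ _ "\<theta>s i"]
  proof (rule sum.cong[OF refl])
    fix l assume "l \<in> {..d}"
    hence "(\<Sum>k\<le>d. X i k * T k l) = \<theta>s i * X i l" using assms X_T by simp
    thus "X i l * z l * Y l j * \<theta>s i = (\<Sum>k\<le>d. X i k * T k l) * z l * Y l j" by simp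
  qed
  also have "\<dots> = (\<Sum>l\<le>d. \<Sum>k\<le>d. X i k * z l * T k l * Y l j)"
    unfolding sum_distrib_right by (intro sum.cong refl) (simp add: ac_simps)
  also have "\<dots> = (\<Sum>k\<le>d. \<Sum>l\<le>d. X i k * z l * T k l * Y l j)"
    by (rule sum.swap)
  finally have 2: "(\<Sum>k\<le>d. X i k * z k * Y k j) * \<theta>s i = (\<Sum>k\<le>d. \<Sum>l\<le>d. X i k * z l * T k l * Y l j)" .
  show ?thesis
    by (simp only: right_diff_distrib 1 2 sum_subtractf[symmetric]) (simp add: algebra_simps)
qed

lemma X_S:
  assumes "k \<le> d" "j \<le> d"
  shows "(\<Sum>i\<le>d. X k i * S m i j) = m k * X k j"
proof -
  have "(\<Sum>i\<le>d. X k i * S m i j) = (\<Sum>i\<le>d. \<Sum>l\<le>d. (X k i * Y i l) * (m l * X l j))"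
    by (simp add: S_def sum_distrib_left mult.assoc)
  also have "\<dots> = (\<Sum>l\<le>d. \<Sum>i\<le>d. (X k i * Y i l) * (m l * X l j))"
    by (rule sum.swap)
  also have "\<dots> = (\<Sum>l\<le>d. (if k = l then 1 else 0) * (m l * X l j))"
    using assms by (intro sum.cong refl) (simp add: sum_distrib_right[symmetric] XY)
  also have "\<dots> = m k * X k j" using assms by (intro sum_atMost_delta)
  finally show ?thesis .
qed

section \<open>Consequences of irreducible tridiagonality of \<open>T\<close>\<close>

text \<open>Row \<open>i\<close> of \<open>X\<close> is a left eigenvector of \<open>T\<close>, so
  each entry is a multiple of entry 0; a zero there would annihilate a row of an invertible
  matrix.\<close>

lemma X_column_nonzero:
  assumes tri: "tridiag d T" and i: "i \<le> d"
  shows "X i 0 \<noteq> 0"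
proof
  assume 0: "X i 0 = 0"
  have "X i k = 0" if k: "k \<le> d" for k
  proof -
    obtain p where "\<forall>t y. (\<forall>k\<le>d. (\<Sum>j\<le>d. y j * T j k) = t * y k) \<longrightarrow> y k = poly p t * y 0"
      using tridiag_left_eigenvector_poly[OF tri k] by blast
    hence "X i k = poly p (\<theta>s i) * X i 0" using X_T[OF i] by blast
    thus ?thesis using 0 by simp
  qed
  hence "(\<Sum>j\<le>d. X i j * Y j i) = 0" by simp
  thus False using XY[OF i i] by simp
qed

text \<open>Equal eigenvalues would make two rows of \<open>X\<close> proportional, as the same
  polynomials are evaluated at the same point.\<close>

lemma \<theta>s_distinct:
  assumes tri: "tridiag d T" and i: "i \<le> d" and j: "j \<le> d" and ij: "i \<noteq> j"
  shows "\<theta>s i \<noteq> \<theta>s j"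
proof
  assume eq: "\<theta>s i = \<theta>s j"
  have "X i 0 * X j k = X j 0 * X i k" if k: "k \<le> d" for k
  proof -
    obtain p where p: "\<forall>t y. (\<forall>k\<le>d. (\<Sum>j\<le>d. y j * T j k) = t * y k) \<longrightarrow> y k = poly p t * y 0"
      using tridiag_left_eigenvector_poly[OF tri k] by blast
    have "X i k = poly p (\<theta>s i) * X i 0" "X j k = poly p (\<theta>s j) * X j 0"
      using p X_T[OF i] X_T[OF j] by blast+
    thus ?thesis using eq by simp
  qed
  hence "X i 0 * (\<Sum>k\<le>d. X j k * Y k j) = X j 0 * (\<Sum>k\<le>d. X i k * Y k j)"
    by (simp add: sum_distrib_left mult.assoc[symmetric])
  hence "X i 0 = 0" using XY i j ij by simp
  thus False using X_column_nonzero[OF tri i] by simp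
qed

text \<open>By \<open>far\<close>, column 0 of \<^term>\<open>S m\<close> is a combination of the first \<open>r + 1\<close> unit vectors;
  multiply it by \<^term>\<open>X\<close>, whose rows are left eigenvectors of \<^term>\<open>T\<close>.\<close>

lemma diagonal_poly:
  assumes tri: "tridiag d T" and r: "r \<le> d"
    and far: "\<And>i. r < i \<Longrightarrow> i \<le> d \<Longrightarrow> S m i 0 = 0"
  shows "\<exists>q. degree q \<le> r \<and> (\<forall>k\<le>d. m k = poly q (\<theta>s k))"
proof -
  have "\<forall>i\<in>{..r}. \<exists>p. degree p \<le> i \<and>
    (\<forall>t y. (\<forall>k\<le>d. (\<Sum>j\<le>d. y j * T j k) = t * y k) \<longrightarrow> y i = poly p t * y 0)"
    using tridiag_left_eigenvector_poly[OF tri] r by auto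
  from bchoice[OF this] obtain p where p: "\<forall>i\<in>{..r}. degree (p i) \<le> i \<and>
    (\<forall>t y. (\<forall>k\<le>d. (\<Sum>j\<le>d. y j * T j k) = t * y k) \<longrightarrow> y i = poly (p i) t * y 0)"
    by (rule exE)
  define q where "q = (\<Sum>i\<le>r. smult (S m i 0) (p i))"
  have "degree q \<le> r" unfolding q_def
    using p by (intro degree_sum_le) (auto intro: order.trans[OF degree_smult_le] order.trans)
  moreover have "m k = poly q (\<theta>s k)" if k: "k \<le> d" for k
  proof -
    have "m k * X k 0 = (\<Sum>i\<le>d. X k i * S m i 0)" using k by (simp add: X_S)
    also have "\<dots> = (\<Sum>i\<le>r. X k i * S m i 0)"
      using r far by (intro sum.mono_neutral_right) auto
    also have "\<dots> = (\<Sum>i\<le>r. S m i 0 * (poly (p i) (\<theta>s k) * X k 0))"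
    proof (rule sum.cong[OF refl])
      fix i assume "i \<in> {..r}"
      hence "X k i = poly (p i) (\<theta>s k) * X k 0" using p X_T[OF k] by blast
      thus "X k i * S m i 0 = S m i 0 * (poly (p i) (\<theta>s k) * X k 0)" by simp
    qed
    also have "\<dots> = poly q (\<theta>s k) * X k 0"
      by (simp add: q_def poly_sum sum_distrib_right mult.assoc)
    finally show ?thesis using X_column_nonzero[OF tri k] by simp
  qed
  ultimately show ?thesis by blast
qed

section \<open>Symmetry and connectedness of the graph\<close>

text \<open>Here \<open>dual.S p\<close> is \<open>X diag(p) Y\<close>: a diagonal operator on the
  eigenbasis of \<open>A\<close>, written in the basis of the \<open>Es i\<close>.\<close>

interpretation dual: diag_pair d Y X T B \<theta>s \<theta>
  by (rule dual)

text \<open>The diagonal form \<open>\<kappa>\<close> makes \<open>A\<close> self-adjoint, so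
  eigenvectors for distinct eigenvalues are orthogonal. \<open>As\<close> is self-adjoint too, hence
  \<open>T\<close> is symmetric up to the non-zero row factors \<open>w i i\<close>.\<close>

lemma T_zero_sym:
  assumes tri: "tridiag d B" and i: "i \<le> d" and j: "j \<le> d"
  shows "T i j = 0 \<longleftrightarrow> T j i = 0"
proof -
  obtain \<kappa> where \<kappa>: "\<And>i. i \<le> d \<Longrightarrow> \<kappa> i \<noteq> 0"
      "\<And>i j. i \<le> d \<Longrightarrow> j \<le> d \<Longrightarrow> \<kappa> i * B i j = \<kappa> j * B j i"
    using tridiag_symmetrizer[OF tri] by blast
  \<comment> \<open>Gram matrix of the columns of \<open>X\<close> for the form
    \<open>\<kappa>\<close>.\<close>
  define w where "w i j = (\<Sum>k\<le>d. X k i * \<kappa> k * X k j)" for i j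
  have w0: "w i j = 0" if ij: "i \<le> d" "j \<le> d" "i \<noteq> j" for i j
  proof -
    have "w i j * \<theta> j = (\<Sum>k\<le>d. X k i * \<kappa> k * (\<Sum>m\<le>d. B k m * X m j))"
      unfolding w_def using ij
      by (subst sum_distrib_right, intro sum.cong refl) (simp add: dual.T_Y ac_simps)
    also have "\<dots> = (\<Sum>k\<le>d. \<Sum>m\<le>d. X k i * (\<kappa> k * B k m) * X m j)"
      by (simp add: sum_distrib_left mult.assoc)
    also have "\<dots> = (\<Sum>k\<le>d. \<Sum>m\<le>d. X k i * (\<kappa> m * B m k) * X m j)"
      by (intro sum.cong refl) (simp add: \<kappa>(2))
    also have "\<dots> = (\<Sum>m\<le>d. \<Sum>k\<le>d. X k i * (\<kappa> m * B m k) * X m j)"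
      by (rule sum.swap)
    also have "\<dots> = (\<Sum>m\<le>d. (\<Sum>k\<le>d. B m k * X k i) * (\<kappa> m * X m j))"
      by (simp add: sum_distrib_left sum_distrib_right ac_simps)
    also have "\<dots> = w i j * \<theta> i"
      unfolding w_def using ij
      by (subst sum_distrib_right, intro sum.cong refl) (simp add: dual.T_Y ac_simps)
    finally have "w i j * (\<theta> j - \<theta> i) = 0" by (simp add: algebra_simps)
    moreover have "\<theta> i \<noteq> \<theta> j" using dual.\<theta>s_distinct[OF tri] ij by blast
    ultimately show ?thesis by simp
  qed
  \<comment> \<open>Since the Gram matrix is diagonal, \<open>Y\<close> is the transpose of
    \<open>X\<close> up to row and column factors.\<close>
  have nY: "w i i * Y i k = X k i * \<kappa> k" if ik: "i \<le> d" "k \<le> d" for i k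
  proof -
    have "w i i * Y i k = (\<Sum>j\<le>d. (if i = j then 1 else 0) * (w i j * Y j k))"
      using ik by (subst sum_atMost_delta) auto
    also have "\<dots> = (\<Sum>j\<le>d. w i j * Y j k)"
      using w0 ik by (intro sum.cong refl) auto
    also have "\<dots> = (\<Sum>j\<le>d. \<Sum>m\<le>d. X m i * \<kappa> m * (X m j * Y j k))"
      by (simp add: w_def sum_distrib_right mult.assoc)
    also have "\<dots> = (\<Sum>m\<le>d. \<Sum>j\<le>d. X m i * \<kappa> m * (X m j * Y j k))"
      by (rule sum.swap)
    also have "\<dots> = (\<Sum>m\<le>d. X m i * \<kappa> m * (if m = k then 1 else 0))"
      using ik by (intro sum.cong refl) (simp add: sum_distrib_left[symmetric] XY)
    also have "\<dots> = X k i * \<kappa> k" using ik by (intro sum_atMost_delta)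
    finally show ?thesis .
  qed
  have nz: "w i i \<noteq> 0" if "i \<le> d" for i
  proof
    assume "w i i = 0"
    hence "X k i = 0" if "k \<le> d" for k using nY[of i k] \<kappa>(1)[of k] that \<open>i \<le> d\<close> by simp
    hence "(\<Sum>k\<le>d. Y i k * X k i) = 0" by simp
    thus False using YX[of i i] \<open>i \<le> d\<close> by simp
  qed
  have nT: "w i i * T i j = (\<Sum>k\<le>d. \<kappa> k * \<theta>s k * X k i * X k j)" if "i \<le> d" "j \<le> d" for i j
    unfolding T_eq[OF that] sum_distrib_left
  proof (rule sum.cong[OF refl])
    fix k assume "k \<in> {..d}"
    hence "w i i * Y i k = X k i * \<kappa> k" using nY that by simp
    thus "w i i * (Y i k * \<theta>s k * X k j) = \<kappa> k * \<theta>s k * X k i * X k j"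
      by (metis (no_types, opaque_lifting) mult.assoc mult.commute)
  qed
  have "w i i * T i j = w j j * T j i"
    unfolding nT[OF i j] nT[OF j i] by (intro sum.cong refl) (simp add: ac_simps)
  thus ?thesis using nz i j by (metis mult_eq_0_iff)
qed

text \<open>If \<^term>\<open>V\<close> is closed under adjacency, its projection commutes with \<^term>\<open>T\<close>, and since
  \<^term>\<open>\<theta>s 0\<close> is a simple eigenvalue it is scalar on the vector \<^term>\<open>\<lambda>i. Y i 0\<close>,
  which has no zero entry.\<close>

lemma T_connected:
  assumes tri: "tridiag d B" and \<theta>s: "\<And>i. 1 \<le> i \<Longrightarrow> i \<le> d \<Longrightarrow> \<theta>s i \<noteq> \<theta>s 0"
    and i: "i \<in> V" "i \<le> d" and j: "j \<notin> V" "j \<le> d"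
  shows "\<exists>v w. v \<in> V \<and> v \<le> d \<and> w \<notin> V \<and> w \<le> d \<and> T v w \<noteq> 0"
proof (rule ccontr)
  assume "\<not> ?thesis"
  hence 0: "T v w = 0" "T w v = 0" if "v \<in> V" "v \<le> d" "w \<notin> V" "w \<le> d" for v w
    using that T_zero_sym[OF tri] by blast+
  define z where "z i = (if i \<in> V then 1 else 0 :: 'a)" for i
  have "dual.S z k 0 * (\<theta>s 0 - \<theta>s k) = 0" if "k \<le> d" for k
    unfolding dual.S_def commutator[OF that le0] using 0 by (auto simp: z_def intro!: sum.neutral)
  hence C: "dual.S z k 0 = 0" if "k \<le> d" "k \<noteq> 0" for k
    using \<theta>s[of k] that by force
  have "z l = dual.S z 0 0" if l: "l \<le> d" for l
  proof -
    have "z l * Y l 0 = (\<Sum>k\<le>d. Y l k * dual.S z k 0)"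
      using l by (simp add: dual.X_S)
    also have "\<dots> = (\<Sum>k\<in>{0}. Y l k * dual.S z k 0)"
      using C by (intro sum.mono_neutral_right) auto
    finally show ?thesis using dual.X_column_nonzero[OF tri l] by simp
  qed
  from this[of i] this[of j] i j show False by (simp add: z_def)
qed

section \<open>The Askey-Wilson relation in the eigenbasis\<close>

text \<open>\<open>rel\<close> says, in the basis of the \<open>Es i\<close>, that \<open>M\<close>
  is diagonal with entries \<open>c\<close>. The same equation is transported to the eigenbasis of
  \<open>A\<close>, where \<open>A\<close> is diagonal and \<open>As\<close> becomes
  \<open>T\<close>.\<close>

lemma Askey_Wilson_entry:
  assumes rel: "\<And>k m. k \<le> d \<Longrightarrow> m \<le> d \<Longrightarrow>
      B k m * ((\<theta>s k)^2 - \<beta> * \<theta>s k * \<theta>s m + (\<theta>s m)^2 - \<gamma>s * (\<theta>s k + \<theta>s m) - \<rho>)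
      = (if k = m then c k else 0)"
    and i: "i \<le> d" and j: "j \<le> d"
  shows "(\<Sum>l\<le>d. T i l * T l j * (\<theta> i + \<theta> j - \<beta> * \<theta> l)) - \<gamma>s * (\<theta> i + \<theta> j) * T i j
      - (if i = j then \<rho> * \<theta> i else 0) = S c i j"
proof -
  \<comment> \<open>Entry \<open>(i, j)\<close> of \<open>p(As) A q(As)\<close>; each monomial of
    \<open>M\<close> is one such \<open>G p q\<close>.\<close>
  define G where "G p q = (\<Sum>k\<le>d. \<Sum>m\<le>d. Y i k * p k * B k m * (q m * X m j))" for p q
  have G: "G p q = (\<Sum>l\<le>d. S p i l * \<theta> l * S q l j)" for p q
    unfolding G_def using S_eigen[OF i j] by simp
  have G1: "G p (\<lambda>_. 1) = S p i j * \<theta> j" for p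
  proof -
    have "G p (\<lambda>_. 1) = (\<Sum>l\<le>d. S p i l * \<theta> l * (if l = j then 1 else 0))"
      unfolding G using j by (intro sum.cong refl) (simp add: S_one)
    also have "\<dots> = S p i j * \<theta> j" using j by (intro sum_atMost_delta)
    finally show ?thesis .
  qed
  have G2: "G (\<lambda>_. 1) p = \<theta> i * S p i j" for p
  proof -
    have "G (\<lambda>_. 1) p = (\<Sum>l\<le>d. (if i = l then 1 else 0) * (\<theta> l * S p l j))"
      unfolding G using i by (intro sum.cong refl) (simp add: S_one)
    also have "\<dots> = \<theta> i * S p i j" using i by (intro sum_atMost_delta)
    finally show ?thesis .
  qed
  have G3: "G \<theta>s \<theta>s = (\<Sum>l\<le>d. T i l * \<theta> l * T l j)"
    unfolding G using i j by (simp add: T_S)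
  have T2: "S (\<lambda>k. (\<theta>s k)^2) i j = (\<Sum>l\<le>d. T i l * T l j)"
    using i j by (simp add: T_S S_mult power2_eq_square)
  have "S c i j = (\<Sum>k\<le>d. \<Sum>m\<le>d. (if k = m then 1 else 0) * (Y i k * c k * X m j))"
    unfolding S_def by (intro sum.cong refl, subst sum_atMost_delta) auto
  also have "\<dots> = (\<Sum>k\<le>d. \<Sum>m\<le>d. Y i k * (B k m * ((\<theta>s k)^2 - \<beta> * \<theta>s k * \<theta>s m
      + (\<theta>s m)^2 - \<gamma>s * (\<theta>s k + \<theta>s m) - \<rho>)) * X m j)"
    by (intro sum.cong refl, subst rel) auto
  also have "\<dots> = G (\<lambda>k. (\<theta>s k)^2) (\<lambda>_. 1) - \<beta> * G \<theta>s \<theta>s + G (\<lambda>_. 1) (\<lambda>k. (\<theta>s k)^2)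
      - \<gamma>s * (G \<theta>s (\<lambda>_. 1) + G (\<lambda>_. 1) \<theta>s) - \<rho> * G (\<lambda>_. 1) (\<lambda>_. 1)"
    unfolding G_def sum_distrib_left sum.distrib[symmetric] sum_subtractf[symmetric]
    by (intro sum.cong refl) (simp add: algebra_simps)
  also have "\<dots> = (\<Sum>l\<le>d. T i l * T l j * (\<theta> i + \<theta> j - \<beta> * \<theta> l)) - \<gamma>s * (\<theta> i + \<theta> j) * T i j
      - (if i = j then \<rho> * \<theta> i else 0)"
    unfolding G1 G2 G3 T2
    using i j by (simp add: T_S[symmetric] S_one algebra_simps sum.distrib sum_subtractf
        sum_distrib_left sum_distrib_right)
  finally show ?thesis by simp
qed

section \<open>From a path to the conditions\<close>

lemma recurrence_exists:
  assumes triB: "tridiag d B" and triT: "tridiag d T" and d: "1 \<le> d"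
  shows "\<exists>\<beta> \<gamma>s. recurrent d \<theta>s \<beta> \<gamma>s"
proof (cases "d < 3")
  case True
  \<comment> \<open>At most the equation for \<open>i = 1\<close> occurs, and this choice of the
    constant solves it with \<open>\<beta> = 0\<close>.\<close>
  have "recurrent d \<theta>s 0 (\<theta>s 0 + \<theta>s 2)"
  proof
    show "\<theta>s 0 + \<theta>s 2 = \<theta>s (i - 1) - 0 * \<theta>s i + \<theta>s (i + 1)" if "1 \<le> i" "i \<le> d - 1" for i
    proof -
      have "i = 1" using that True by simp
      thus ?thesis by (simp add: numeral_2_eq_2)
    qed
  qed fact
  thus ?thesis by blast
next
  case False
  \<comment> \<open>Values of the polynomial sought at the eigenvalues. The increments make the
    commutator of \<open>diag(z)\<close> with \<open>T\<close> equal to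
    \<open>A^2 As A - A As A^2\<close> on the support of \<open>T\<close>.\<close>
  define z where "z i = (\<Sum>k<i. \<theta> k * \<theta> (Suc k) * (\<theta> (Suc k) - \<theta> k))" for i
  define B2 where "B2 = dual.S (\<lambda>k. (\<theta> k)^2)"
  define C where "C = dual.S z"
  have zT: "(z k - z l) * T k l = ((\<theta> k)^2 * \<theta> l - \<theta> k * (\<theta> l)^2) * T k l"
    if "k \<le> d" "l \<le> d" for k l
  proof -
    consider "k + 1 < l \<or> l + 1 < k" | "k = l" | "l = Suc k" | "k = Suc l" by linarith
    thus ?thesis
    proof cases
      case 1
      thus ?thesis using tridiag_far[OF triT that] by simp
    qed (simp_all add: z_def power2_eq_square algebra_simps)
  qed
  have comm: "C i j * (\<theta>s j - \<theta>s i)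
      = (\<Sum>l\<le>d. (B2 i l * \<theta>s l) * B l j) - (\<Sum>l\<le>d. (B i l * \<theta>s l) * B2 l j)"
    if ij: "i \<le> d" "j \<le> d" for i j
  proof -
    have "C i j * (\<theta>s j - \<theta>s i)
        = (\<Sum>k\<le>d. \<Sum>l\<le>d. X i k * (((\<theta> k)^2 * \<theta> l - \<theta> k * (\<theta> l)^2) * T k l) * Y l j)"
      unfolding C_def dual.S_def commutator[OF ij] using zT by (intro sum.cong refl) simp
    also have "\<dots> = (\<Sum>k\<le>d. \<Sum>l\<le>d. X i k * (\<theta> k)^2 * T k l * (\<theta> l * Y l j))
        - (\<Sum>k\<le>d. \<Sum>l\<le>d. X i k * \<theta> k * T k l * ((\<theta> l)^2 * Y l j))"
      unfolding sum_subtractf[symmetric] by (intro sum.cong refl) (simp add: algebra_simps)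
    also have "\<dots> = (\<Sum>l\<le>d. B2 i l * \<theta>s l * dual.S \<theta> l j) - (\<Sum>l\<le>d. dual.S \<theta> i l * \<theta>s l * B2 l j)"
      unfolding B2_def dual.S_eigen[OF ij] ..
    finally show ?thesis using ij by (simp add: dual.T_S)
  qed
  have B2: "B2 i j = (\<Sum>l\<le>d. B i l * B l j)" if "i \<le> d" "j \<le> d" for i j
    using that by (simp add: B2_def dual.T_S dual.S_mult power2_eq_square)
  have band: "i \<le> d \<Longrightarrow> j \<le> d \<Longrightarrow> j + 1 < i \<Longrightarrow> B i j = 0" for i j
    using tridiag_far[OF triB] by simp
  have band2: "B2 i j = 0" if "i \<le> d" "j \<le> d" "j + 2 < i" for i j
    unfolding B2[OF that(1,2)] using that band
    by (intro sum_lower_band(1)[of d 1 i B j 1 B]) auto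
  have step2: "B2 (j + 2) j = B (j + 2) (j + 1) * B (j + 1) j" if "j + 2 \<le> d" for j
  proof -
    have "(\<Sum>l\<le>d. B (j + 2) l * B l j) = B (j + 2) (j + 1) * B (j + 1) j"
      using that band by (intro sum_lower_band(2)[of d 1 "j + 2" B j 1 B]) auto
    thus ?thesis using B2 that by simp
  qed
  have L0: "(\<Sum>l\<le>d. (B2 i l * \<theta>s l) * B l j) = 0" "(\<Sum>l\<le>d. (B i l * \<theta>s l) * B2 l j) = 0"
      "(\<Sum>l\<le>d. B2 i l * B l j) = 0"
    if "i \<le> d" "j + 3 < i" for i j
  proof -
    show "(\<Sum>l\<le>d. (B2 i l * \<theta>s l) * B l j) = 0"
      using that band band2 by (intro sum_lower_band(1)[of d 2 i "\<lambda>i l. B2 i l * \<theta>s l" j 1 B]) auto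
    show "(\<Sum>l\<le>d. (B i l * \<theta>s l) * B2 l j) = 0"
      using that band band2 by (intro sum_lower_band(1)[of d 1 i "\<lambda>i l. B i l * \<theta>s l" j 2 B2]) auto
    show "(\<Sum>l\<le>d. B2 i l * B l j) = 0"
      using that band band2 by (intro sum_lower_band(1)[of d 2 i B2 j 1 B]) auto
  qed
  \<comment> \<open>Below row 3 the right side of \<open>comm\<close> vanishes by bandwidth, while
    \<open>\<theta>s i\<close> differs from \<open>\<theta>s 0\<close>. Then
    \<open>diagonal_poly\<close> makes \<open>z\<close> a polynomial of degree at most 3 in
    \<open>\<theta>\<close>.\<close>
  have "C i 0 = 0" if "3 < i" "i \<le> d" for i
    using comm[of i 0] L0[of i 0] that \<theta>s_distinct[OF triT, of i 0] by simp
  then obtain q where q: "degree q \<le> 3" "\<And>k. k \<le> d \<Longrightarrow> z k = poly q (\<theta> k)"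
    using dual.diagonal_poly[OF triB, of 3 z] False unfolding C_def by auto
  define c where "c = coeff q"
  have zq: "z k = c 0 + c 1 * \<theta> k + c 2 * (\<theta> k)^2 + c 3 * (\<theta> k)^3" if "k \<le> d" for k
  proof -
    have "z k = (\<Sum>i\<le>3. c i * (\<theta> k)^i)"
      unfolding c_def q(2)[OF that] by (rule poly_sum_of_degree_le) (rule q(1))
    thus ?thesis by (simp add: numeral_3_eq_3 numeral_2_eq_2 algebra_simps)
  qed
  \<comment> \<open>Entry \<open>(i + 3, i)\<close> of \<open>comm\<close>: only the cubic term of
    \<open>C\<close> contributes, and every product reduces to \<open>\<pi>\<close>, the product of
    three subdiagonal entries.\<close>
  have key: "c 3 * (\<theta>s i - \<theta>s (i + 3)) = \<theta>s (i + 1) - \<theta>s (i + 2)" if i: "i + 3 \<le> d" for i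
  proof -
    define \<pi> where "\<pi> = B (i + 3) (i + 2) * B (i + 2) (i + 1) * B (i + 1) i"
    have "\<pi> \<noteq> 0" using tridiag_near[OF triB] i by (simp add: \<pi>_def)
    have B3: "(\<Sum>l\<le>d. B2 (i + 3) l * B l i) = \<pi>"
    proof -
      have "(\<Sum>l\<le>d. B2 (i + 3) l * B l i) = B2 (i + 3) (i + 1) * B (i + 1) i"
        using i band band2 by (intro sum_lower_band(2)[of d 2 "i + 3" B2 i 1 B]) auto
      thus ?thesis using step2[of "i + 1"] i by (simp add: \<pi>_def numeral_3_eq_3)
    qed
    have L: "(\<Sum>l\<le>d. (B2 (i + 3) l * \<theta>s l) * B l i) = \<pi> * \<theta>s (i + 1)"
    proof -
      have "(\<Sum>l\<le>d. (B2 (i + 3) l * \<theta>s l) * B l i) = (B2 (i + 3) (i + 1) * \<theta>s (i + 1)) * B (i + 1) i"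
        using i band band2
        by (intro sum_lower_band(2)[of d 2 "i + 3" "\<lambda>i l. B2 i l * \<theta>s l" i 1 B]) auto
      thus ?thesis using step2[of "i + 1"] i by (simp add: \<pi>_def numeral_3_eq_3)
    qed
    have R: "(\<Sum>l\<le>d. (B (i + 3) l * \<theta>s l) * B2 l i) = \<pi> * \<theta>s (i + 2)"
    proof -
      have "(\<Sum>l\<le>d. (B (i + 3) l * \<theta>s l) * B2 l i) = (B (i + 3) (i + 2) * \<theta>s (i + 2)) * B2 (i + 2) i"
        using i band band2
        by (intro sum_lower_band(2)[of d 1 "i + 3" "\<lambda>i l. B i l * \<theta>s l" i 2 B2]) auto
      thus ?thesis using step2[of i] i by (simp add: \<pi>_def)
    qed
    have "C (i + 3) i = c 0 * dual.S (\<lambda>_. 1) (i + 3) i + c 1 * dual.S \<theta> (i + 3) i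
        + c 2 * B2 (i + 3) i + c 3 * dual.S (\<lambda>k. (\<theta> k)^2 * \<theta> k) (i + 3) i"
      unfolding C_def B2_def dual.S_def sum_distrib_left sum.distrib[symmetric]
      by (intro sum.cong refl) (simp add: zq algebra_simps power2_eq_square power3_eq_cube)
    also have "dual.S (\<lambda>_. 1) (i + 3) i = 0" using dual.S_one i by simp
    also have "dual.S \<theta> (i + 3) i = 0" using band[of "i + 3" i] dual.T_S[of "i + 3" i] i by simp
    also have "B2 (i + 3) i = 0" using band2 i by simp
    also have "dual.S (\<lambda>k. (\<theta> k)^2 * \<theta> k) (i + 3) i = \<pi>"
      using dual.S_mult[of "i + 3" i "\<lambda>k. (\<theta> k)^2" \<theta>] i B3 by (simp add: B2_def dual.T_S)
    finally have "C (i + 3) i = c 3 * \<pi>" by simp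
    hence "c 3 * \<pi> * (\<theta>s i - \<theta>s (i + 3)) = \<pi> * \<theta>s (i + 1) - \<pi> * \<theta>s (i + 2)"
      using comm[of "i + 3" i] i L R by simp
    hence "\<pi> * (c 3 * (\<theta>s i - \<theta>s (i + 3))) = \<pi> * (\<theta>s (i + 1) - \<theta>s (i + 2))"
      by (simp only: ac_simps right_diff_distrib)
    thus ?thesis using \<open>\<pi> \<noteq> 0\<close> by simp
  qed
  have c3: "c 3 \<noteq> 0"
    using key[of 0] \<theta>s_distinct[OF triT, of 1 2] False by (auto simp: numeral_2_eq_2)
  \<comment> \<open>By \<open>key\<close>, \<open>\<beta> + 1\<close> is the constant ratio of
    \<open>\<theta>s i - \<theta>s (i + 3)\<close> to
    \<open>\<theta>s (i + 1) - \<theta>s (i + 2)\<close>, so the expression for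
    \<open>\<gamma>s\<close> does not change when shifted.\<close>
  define \<beta> where "\<beta> = 1 / c 3 - 1"
  define \<gamma>s where "\<gamma>s = \<theta>s 0 - \<beta> * \<theta>s 1 + \<theta>s 2"
  have "i + 2 \<le> d \<Longrightarrow> \<gamma>s = \<theta>s i - \<beta> * \<theta>s (i + 1) + \<theta>s (i + 2)" for i
  proof (induction i)
    case 0
    show ?case by (simp add: \<gamma>s_def numeral_2_eq_2)
  next
    case (Suc i)
    have "\<theta>s i - \<theta>s (i + 3) = (1 / c 3) * (\<theta>s (i + 1) - \<theta>s (i + 2))"
      using key[of i] Suc.prems c3 by (simp add: field_simps)
    hence "\<theta>s i - \<theta>s (i + 3) = (\<beta> + 1) * (\<theta>s (i + 1) - \<theta>s (i + 2))" by (simp add: \<beta>_def)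
    hence "\<theta>s i = \<theta>s (i + 3) + (\<beta> + 1) * (\<theta>s (i + 1) - \<theta>s (i + 2))" by (simp add: diff_eq_eq add.commute)
    moreover have "\<gamma>s = \<theta>s i - \<beta> * \<theta>s (i + 1) + \<theta>s (i + 2)" using Suc by simp
    ultimately have "\<gamma>s = \<theta>s (i + 1) - \<beta> * \<theta>s (i + 2) + \<theta>s (i + 3)"
      by (simp only:) (simp add: algebra_simps)
    thus ?case by (simp add: numeral_3_eq_3)
  qed
  hence "\<gamma>s = \<theta>s (i - 1) - \<beta> * \<theta>s i + \<theta>s (i + 1)" if "1 \<le> i" "i \<le> d - 1" for i
    using that by (cases i) (auto simp: numeral_2_eq_2)
  hence "recurrent d \<theta>s \<beta> \<gamma>s" using d by unfold_locales auto
  thus ?thesis by blast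
qed

text \<open>\<open>M\<close> is diagonal with entries \<open>c\<close> in one basis and has lower
  bandwidth 2 in the other, as no monomial contains \<open>T\<close> more than twice.
  \<open>diagonal_poly\<close> converts this into a degree bound.\<close>

lemma quadratic_exists:
  assumes triB: "tridiag d B" and triT: "tridiag d T" and rec: "recurrent d \<theta>s \<beta> \<gamma>s"
  shows "\<exists>\<gamma> \<omega> \<eta>. \<forall>i\<le>d. B i i * (\<theta>s i - recurrent.prv \<theta>s \<beta> \<gamma>s i) * (\<theta>s i - recurrent.nxt d \<theta>s \<beta> \<gamma>s i)
      = \<gamma> * (\<theta>s i)^2 + \<omega> * \<theta>s i + \<eta>"
proof -
  interpret R: recurrent d \<theta>s \<beta> \<gamma>s by (rule rec)
  define c where "c = (\<lambda>k. B k k * (\<theta>s k - R.prv k) * (\<theta>s k - R.nxt k))"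
  have band: "i \<le> d \<Longrightarrow> j \<le> d \<Longrightarrow> j + 1 < i \<Longrightarrow> T i j = 0" for i j
    using tridiag_far[OF triT] by simp
  \<comment> \<open>The minimum covers \<open>d = 1\<close>, since \<open>diagonal_poly\<close> asks
    for a bound of at most \<open>d\<close>.\<close>
  have "S c i 0 = 0" if i: "min 2 d < i" "i \<le> d" for i
  proof -
    have "2 < i" using i by auto
    have "(\<Sum>l\<le>d. T i l * T l 0 * (\<theta> i + \<theta> 0 - \<beta> * \<theta> l))
        = (\<Sum>l\<le>d. (T i l * (\<theta> i + \<theta> 0 - \<beta> * \<theta> l)) * T l 0)"
      by (simp only: ac_simps)
    also have "\<dots> = 0"
      using band i \<open>2 < i\<close>
      by (intro sum_lower_band(1)[of d 1 i "\<lambda>i l. T i l * (\<theta> i + \<theta> 0 - \<beta> * \<theta> l)" 0 1 T]) auto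
    finally show ?thesis
      using Askey_Wilson_entry[OF R.tridiag_relation[OF triB] i(2), of 0] band[of i 0] i \<open>2 < i\<close>
      by (simp add: c_def)
  qed
  then obtain q where q: "degree q \<le> min 2 d" "\<And>k. k \<le> d \<Longrightarrow> c k = poly q (\<theta>s k)"
    using diagonal_poly[OF triT, of "min 2 d" c] by auto
  have "c k = coeff q 2 * (\<theta>s k)^2 + coeff q 1 * \<theta>s k + coeff q 0" if "k \<le> d" for k
  proof -
    have "c k = (\<Sum>i\<le>2. coeff q i * (\<theta>s k)^i)"
      unfolding q(2)[OF that] by (rule poly_sum_of_degree_le) (use q(1) in simp)
    thus ?thesis by (simp add: numeral_2_eq_2 algebra_simps)
  qed
  thus ?thesis unfolding c_def by blast
qed

text \<open>Only the eigenbasis of \<open>A\<close> is permuted; the order of the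
  \<open>Es i\<close>, and with it \<open>B\<close>, stays fixed.\<close>

lemma reindex:
  assumes x: "bij_betw x {..d} {..d}"
  shows "diag_pair d (\<lambda>i k. X i (x k)) (\<lambda>k j. Y (x k) j) B (\<lambda>i j. T (x i) (x j)) (\<lambda>k. \<theta> (x k)) \<theta>s"
proof
  have xd: "i \<le> d \<Longrightarrow> x i \<le> d" for i using bij_betwE[OF x] by auto
  have inj: "i \<le> d \<Longrightarrow> j \<le> d \<Longrightarrow> x i = x j \<longleftrightarrow> i = j" for i j
    using bij_betw_imp_inj_on[OF x] by (auto simp: inj_on_def)
  fix i j assume ij: "i \<le> d" "j \<le> d"
  show "(\<Sum>k\<le>d. X i (x k) * Y (x k) j) = (if i = j then 1 else 0)"
    using sum.reindex_bij_betw[OF x, of "\<lambda>k. X i k * Y k j"] XY[OF ij] by simp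
  show "(\<Sum>k\<le>d. Y (x i) k * X k (x j)) = (if i = j then 1 else 0)"
    using YX[OF xd[OF ij(1)] xd[OF ij(2)]] inj[OF ij] by simp
  show "B i j = (\<Sum>k\<le>d. X i (x k) * \<theta> (x k) * Y (x k) j)"
    using sum.reindex_bij_betw[OF x, of "\<lambda>k. X i k * \<theta> k * Y k j"] B_eq[OF ij] by simp
  show "T (x i) (x j) = (\<Sum>k\<le>d. Y (x i) k * \<theta>s k * X k (x j))"
    using T_eq[OF xd[OF ij(1)] xd[OF ij(2)]] .
qed

section \<open>From the conditions to a path\<close>

text \<open>Equating \<open>M\<close> with a quadratic in \<open>As\<close> at a non-adjacent pair
  gives a sum over common neighbours. A single common neighbour fixes
  \<open>\<theta> i + \<theta> j\<close>, so the next vertex of the path is determined by its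
  eigenvalue.\<close>

lemma quadratic_path:
  assumes tri: "tridiag d B" and rec: "recurrent d \<theta>s \<beta> \<gamma>s"
    and quad: "\<And>i. i \<le> d \<Longrightarrow>
      B i i * (\<theta>s i - recurrent.prv \<theta>s \<beta> \<gamma>s i) * (\<theta>s i - recurrent.nxt d \<theta>s \<beta> \<gamma>s i)
      = \<gamma> * (\<theta>s i)^2 + \<omega> * \<theta>s i + \<eta>"
    and leaf: "has_leaf d (\<lambda>i j. i \<noteq> j \<and> T i j \<noteq> 0)"
    and \<theta>s: "\<And>i. 1 \<le> i \<Longrightarrow> i \<le> d \<Longrightarrow> \<theta>s i \<noteq> \<theta>s 0"
  shows "is_path_graph d (\<lambda>i j. i \<noteq> j \<and> T i j \<noteq> 0)"
proof -
  interpret R: recurrent d \<theta>s \<beta> \<gamma>s by (rule rec)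
  have T2: "(\<Sum>l\<le>d. T i l * T l j * (\<theta> i + \<theta> j - \<beta> * \<theta> l - \<gamma>)) = 0"
    if ij: "i \<le> d" "j \<le> d" "i \<noteq> j" "T i j = 0" for i j
  proof -
    define c where "c k = \<gamma> * (\<theta>s k)^2 + \<omega> * \<theta>s k + \<eta>" for k
    have rel: "B k m * ((\<theta>s k)^2 - \<beta> * \<theta>s k * \<theta>s m + (\<theta>s m)^2 - \<gamma>s * (\<theta>s k + \<theta>s m) - R.\<rho>)
      = (if k = m then c k else 0)" if "k \<le> d" "m \<le> d" for k m
      using R.tridiag_relation[OF tri that] quad that by (simp add: c_def)
    have "S c i j = \<gamma> * S (\<lambda>k. \<theta>s k * \<theta>s k) i j + \<omega> * S \<theta>s i j + \<eta> * S (\<lambda>_. 1) i j"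
      unfolding S_def c_def sum_distrib_left sum.distrib[symmetric]
      by (intro sum.cong refl) (simp add: algebra_simps power2_eq_square)
    also have "\<dots> = (\<Sum>l\<le>d. \<gamma> * (T i l * T l j))"
      using ij by (simp add: S_mult[symmetric] T_S[symmetric] S_one sum_distrib_left)
    finally have "(\<Sum>l\<le>d. T i l * T l j * (\<theta> i + \<theta> j - \<beta> * \<theta> l)) = (\<Sum>l\<le>d. \<gamma> * (T i l * T l j))"
      using Askey_Wilson_entry[OF rel ij(1,2)] ij by simp
    thus ?thesis by (simp add: right_diff_distrib sum_subtractf mult.commute)
  qed
  have det: "\<theta> i + \<theta> j = \<beta> * \<theta> l + \<gamma>"
    if "i \<le> d" "j \<le> d" "l \<le> d" "i \<noteq> j" "T i j = 0" "T i l \<noteq> 0" "T l j \<noteq> 0"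
      and only: "\<And>m. m \<le> d \<Longrightarrow> m \<noteq> i \<Longrightarrow> m \<noteq> j \<Longrightarrow> T i m \<noteq> 0 \<Longrightarrow> T m j \<noteq> 0 \<Longrightarrow> m = l" for i j l
  proof -
    \<comment> \<open>The summands at \<open>i\<close> and \<open>j\<close> vanish because each
      contains the factor \<open>T i j\<close>.\<close>
    have "T i m * T m j = 0" if "m \<le> d" "m \<noteq> l" for m
      using only[of m] that \<open>T i j = 0\<close> by (cases "m = i \<or> m = j") auto
    hence "(\<Sum>m\<le>d. T i m * T m j * (\<theta> i + \<theta> j - \<beta> * \<theta> m - \<gamma>))
        = (\<Sum>m\<in>{l}. T i m * T m j * (\<theta> i + \<theta> j - \<beta> * \<theta> m - \<gamma>))"
      using \<open>l \<le> d\<close> by (intro sum.mono_neutral_right) auto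
    hence "\<theta> i + \<theta> j - \<beta> * \<theta> l - \<gamma> = 0"
      using T2[of i j] that(1-7) by simp
    thus ?thesis by (simp add: algebra_simps)
  qed
  show ?thesis
  proof (rule path_graph_greedy[OF _ _ _ leaf])
    show "i \<le> d \<Longrightarrow> j \<le> d \<Longrightarrow> i \<noteq> j \<and> T i j \<noteq> 0 \<Longrightarrow> j \<noteq> i \<and> T j i \<noteq> 0" for i j
      using T_zero_sym[OF tri] by blast
    show "\<not> (i \<noteq> i \<and> T i i \<noteq> 0)" for i by simp
    show "\<exists>v w. v \<in> V \<and> v \<le> d \<and> w \<notin> V \<and> w \<le> d \<and> v \<noteq> w \<and> T v w \<noteq> 0"
      if "i \<in> V" "i \<le> d" "j \<notin> V" "j \<le> d" for V i j
      using T_connected[OF tri \<theta>s that] by blast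
    fix i l j k
    assume le: "i \<le> d" "l \<le> d" "j \<le> d" "k \<le> d"
      and il: "i \<noteq> l \<and> T i l \<noteq> 0" and lj: "l \<noteq> j \<and> T l j \<noteq> 0" and lk: "l \<noteq> k \<and> T l k \<noteq> 0"
      and ij: "i \<noteq> j" "i \<noteq> k" "\<not> (i \<noteq> j \<and> T i j \<noteq> 0)" "\<not> (i \<noteq> k \<and> T i k \<noteq> 0)"
      and only: "\<And>m. m \<le> d \<Longrightarrow> i \<noteq> m \<and> T i m \<noteq> 0 \<Longrightarrow>
          m \<noteq> j \<and> T m j \<noteq> 0 \<or> m \<noteq> k \<and> T m k \<noteq> 0 \<Longrightarrow> m = l"
    have "\<theta> i + \<theta> j = \<beta> * \<theta> l + \<gamma>"
      by (rule det) (use le il lj ij in blast | rule only; blast)+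
    moreover have "\<theta> i + \<theta> k = \<beta> * \<theta> l + \<gamma>"
      by (rule det) (use le il lk ij in blast | rule only; blast)+
    ultimately have "\<theta> j = \<theta> k" by (metis add_left_cancel)
    thus "j = k" using dual.\<theta>s_distinct[OF tri] le by blast
  qed
qed

text \<open>Forwards, the eigenbasis is relabelled along the path so that both matrices become
  tridiagonal; the conditions on \<open>B\<close> and \<open>\<theta>s\<close> are unaffected by
  this.\<close>

theorem path_iff:
  assumes tri: "tridiag d B" and d: "1 \<le> d"
  shows "is_path_graph d (\<lambda>i j. i \<noteq> j \<and> T i j \<noteq> 0) \<longleftrightarrow>
    has_leaf d (\<lambda>i j. i \<noteq> j \<and> T i j \<noteq> 0) \<and>
    (\<exists>\<beta> \<gamma>s. recurrent d \<theta>s \<beta> \<gamma>s \<and>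
      (\<exists>\<gamma> \<omega> \<eta>. \<forall>i\<le>d.
        B i i * (\<theta>s i - recurrent.prv \<theta>s \<beta> \<gamma>s i) * (\<theta>s i - recurrent.nxt d \<theta>s \<beta> \<gamma>s i)
        = \<gamma> * (\<theta>s i)^2 + \<omega> * \<theta>s i + \<eta>)) \<and>
    (\<forall>i. 1 \<le> i \<and> i \<le> d \<longrightarrow> \<theta>s i \<noteq> \<theta>s 0)"
proof
  assume path: "is_path_graph d (\<lambda>i j. i \<noteq> j \<and> T i j \<noteq> 0)"
  obtain x where x: "bij_betw x {..d} {..d}" and triT: "tridiag d (\<lambda>i j. T (x i) (x j))"
    using path_graph_tridiag[OF path] by blast
  interpret P: diag_pair d "\<lambda>i k. X i (x k)" "\<lambda>k j. Y (x k) j" B "\<lambda>i j. T (x i) (x j)"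
    "\<lambda>k. \<theta> (x k)" \<theta>s by (rule reindex[OF x])
  obtain \<beta> \<gamma>s where R: "recurrent d \<theta>s \<beta> \<gamma>s" using P.recurrence_exists[OF tri triT d] by blast
  show "has_leaf d (\<lambda>i j. i \<noteq> j \<and> T i j \<noteq> 0) \<and>
    (\<exists>\<beta> \<gamma>s. recurrent d \<theta>s \<beta> \<gamma>s \<and>
      (\<exists>\<gamma> \<omega> \<eta>. \<forall>i\<le>d.
        B i i * (\<theta>s i - recurrent.prv \<theta>s \<beta> \<gamma>s i) * (\<theta>s i - recurrent.nxt d \<theta>s \<beta> \<gamma>s i)
        = \<gamma> * (\<theta>s i)^2 + \<omega> * \<theta>s i + \<eta>)) \<and>
    (\<forall>i. 1 \<le> i \<and> i \<le> d \<longrightarrow> \<theta>s i \<noteq> \<theta>s 0)"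
  proof (intro conjI)
    show "\<exists>\<beta> \<gamma>s. recurrent d \<theta>s \<beta> \<gamma>s \<and>
      (\<exists>\<gamma> \<omega> \<eta>. \<forall>i\<le>d.
        B i i * (\<theta>s i - recurrent.prv \<theta>s \<beta> \<gamma>s i) * (\<theta>s i - recurrent.nxt d \<theta>s \<beta> \<gamma>s i)
        = \<gamma> * (\<theta>s i)^2 + \<omega> * \<theta>s i + \<eta>)"
      by (rule exI[of _ \<beta>], rule exI[of _ \<gamma>s], rule conjI)
        (fact R P.quadratic_exists[OF tri triT R])+
    show "\<forall>i. 1 \<le> i \<and> i \<le> d \<longrightarrow> \<theta>s i \<noteq> \<theta>s 0" using P.\<theta>s_distinct[OF triT] by simp
  qed (fact path_graph_has_leaf[OF path])
qed (use quadratic_path[OF tri] in blast)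

end

section \<open>Systems of rank one idempotents\<close>

lemma index_mult_mat_sum:
  assumes "M \<in> carrier_mat n m" "N \<in> carrier_mat m k" "i < n" "j < k"
  shows "(M * N) $$ (i, j) = (\<Sum>l<m. M $$ (i, l) * N $$ (l, j))"
  using assms by (simp add: scalar_prod_def atLeast0LessThan)

lemma index_mult_mat_vec_sum:
  assumes "M \<in> carrier_mat n m" "v \<in> carrier_vec m" "r < n"
  shows "(M *\<^sub>v v) $ r = (\<Sum>k<m. M $$ (r, k) * v $ k)"
  using assms by (simp add: scalar_prod_def atLeast0LessThan)

lemma smult_mat_mult_vec:
  fixes M :: "'a::comm_ring_1 mat"
  assumes M: "M \<in> carrier_mat n m" and v: "v \<in> carrier_vec m"
  shows "(k \<cdot>\<^sub>m M) *\<^sub>v v = k \<cdot>\<^sub>v (M *\<^sub>v v)"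
proof (rule eq_vecI)
  fix r assume "r < dim_vec (k \<cdot>\<^sub>v (M *\<^sub>v v))"
  hence r: "r < n" using M by simp
  have kM: "k \<cdot>\<^sub>m M \<in> carrier_mat n m" using M by simp
  have "((k \<cdot>\<^sub>m M) *\<^sub>v v) $ r = k * (M *\<^sub>v v) $ r"
    unfolding index_mult_mat_vec_sum[OF kM v r] index_mult_mat_vec_sum[OF M v r] sum_distrib_left
    using M r by (intro sum.cong refl) (simp add: mult.assoc)
  thus "((k \<cdot>\<^sub>m M) *\<^sub>v v) $ r = (k \<cdot>\<^sub>v (M *\<^sub>v v)) $ r" using M r by simp
qed (use M in simp)

text \<open>All columns lie in the span of a maximal independent set of columns, which rank one
  makes a singleton; the coefficients form the row factor.\<close>

lemma rank_one_factor:
  fixes M :: "'a::field mat"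
  assumes M: "M \<in> carrier_mat n m" and rank: "vec_space.rank n M = 1"
  shows "\<exists>u c. \<forall>r<n. \<forall>j<m. M $$ (r, j) = u r * c j"
proof -
  interpret vec_space "TYPE('a)" n .
  let ?P = "\<lambda>S. S \<subseteq> set (cols M) \<and> lin_indpt S"
  have cols: "set (cols M) \<subseteq> carrier_vec n" using cols_dim M by blast
  have "lin_indpt {}" by (simp add: lin_dep_def)
  then obtain S where S: "maximal S ?P" and fin: "finite S"
    using maximal_exists_superset[of "set (cols M)" ?P "{}"] by auto
  have "card S = 1" using rank_card_indpt[OF M S] rank by simp
  then obtain s where s: "S = {s}" by (auto simp: card_1_singleton_iff)
  have li: "S \<subseteq> set (cols M)" "lin_indpt S" using S by (auto simp: maximal_def)
  have Sc: "S \<subseteq> carrier_vec n" using li cols by blast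
  have "\<exists>a. \<forall>r<n. M $$ (r, j) = s $ r * a" if j: "j < m" for j
  proof -
    have cj: "col M j \<in> set (cols M)" using M j by (auto simp: cols_def)
    have "col M j \<in> span S"
    proof (rule ccontr)
      assume n: "col M j \<notin> span S"
      have nS: "col M j \<notin> S" using n in_own_span[OF Sc] by blast
      hence "lin_indpt (insert (col M j) S)"
        using lin_dep_iff_in_span[of S "col M j"] n Sc li cols cj by auto
      hence "?P (insert (col M j) S)" using li cj by auto
      thus False using S nS unfolding maximal_def by blast
    qed
    then obtain a where "lincomb a S = col M j"
      using finite_in_span[OF fin, of "col M j"] Sc by auto
    hence "col M j $ r = a s * s $ r" if "r < n" for r
      using lincomb_index[OF that Sc, of a] by (simp add: s)
    hence "\<forall>r<n. M $$ (r, j) = s $ r * a s" using M j by (simp add: mult.commute)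
    thus ?thesis ..
  qed
  hence "\<forall>j\<in>{..<m}. \<exists>a. \<forall>r<n. M $$ (r, j) = s $ r * a" by blast
  from bchoice[OF this] obtain c where "\<forall>j\<in>{..<m}. \<forall>r<n. M $$ (r, j) = s $ r * c j" ..
  thus ?thesis by (intro exI[of _ "\<lambda>r. s $ r"] exI[of _ c]) auto
qed

text \<open>A simultaneous diagonalisation: \<open>E i\<close> is the \<open>i\<close>-th matrix
  unit conjugated by \<open>U\<close>, and column \<open>i\<close> of \<open>U\<close> spans its
  image.\<close>

definition rank_one_frame ::
    "nat \<Rightarrow> 'a::field mat \<Rightarrow> 'a mat \<Rightarrow> (nat \<Rightarrow> 'a mat) \<Rightarrow> bool" where
  "rank_one_frame n U V E \<longleftrightarrow>
     U \<in> carrier_mat n n \<and> V \<in> carrier_mat n n \<and> U * V = 1\<^sub>m n \<and> V * U = 1\<^sub>m n \<and>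
     (\<forall>i<n. E i \<in> carrier_mat n n \<and> (\<forall>r<n. \<forall>c<n. E i $$ (r, c) = U $$ (r, i) * V $$ (i, c)))"

lemma rank_one_frameD:
  assumes "rank_one_frame n U V E"
  shows "U \<in> carrier_mat n n" "V \<in> carrier_mat n n" "U * V = 1\<^sub>m n" "V * U = 1\<^sub>m n"
    and "i < n \<Longrightarrow> E i \<in> carrier_mat n n"
    and "i < n \<Longrightarrow> r < n \<Longrightarrow> c < n \<Longrightarrow> E i $$ (r, c) = U $$ (r, i) * V $$ (i, c)"
  using assms unfolding rank_one_frame_def by blast+

lemma rank_one_frame_sum:
  assumes "rank_one_frame n U V E" "i < n" "j < n"
  shows "(\<Sum>l<n. U $$ (i, l) * V $$ (l, j)) = (if i = j then 1 else 0)"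
    and "(\<Sum>l<n. V $$ (i, l) * U $$ (l, j)) = (if i = j then 1 else 0)"
proof -
  note c = rank_one_frameD(1,2)[OF assms(1)]
  have "(U * V) $$ (i, j) = (1\<^sub>m n) $$ (i, j)" "(V * U) $$ (i, j) = (1\<^sub>m n) $$ (i, j)"
    by (simp_all only: rank_one_frameD(3,4)[OF assms(1)])
  thus "(\<Sum>l<n. U $$ (i, l) * V $$ (l, j)) = (if i = j then 1 else 0)"
    "(\<Sum>l<n. V $$ (i, l) * U $$ (l, j)) = (if i = j then 1 else 0)"
    using index_mult_mat_sum[OF c assms(2,3)] index_mult_mat_sum[OF c(2,1) assms(2,3)] assms(2,3)
    by simp_all
qed

lemma rank_one_frame_mult:
  assumes fr: "rank_one_frame n U V E" and M: "M \<in> carrier_mat n n"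
    and i: "i < n" and r: "r < n" and c: "c < n"
  shows "(E i * M) $$ (r, c) = U $$ (r, i) * (V * M) $$ (i, c)"
proof -
  note V = rank_one_frameD(2)[OF fr] and E = rank_one_frameD(5)[OF fr i]
    and e = rank_one_frameD(6)[OF fr i r]
  show ?thesis
    unfolding index_mult_mat_sum[OF E M r c] index_mult_mat_sum[OF V M i c] sum_distrib_left
    by (intro sum.cong refl) (simp add: e mult.assoc)
qed

lemma rank_one_frame_trace:
  assumes fr: "rank_one_frame n U V E" and M: "M \<in> carrier_mat n n" and i: "i < n"
  shows "mat_tr (E i * M) = (V * M * U) $$ (i, i)"
proof -
  note U = rank_one_frameD(1)[OF fr]
    and VM = mult_carrier_mat[OF rank_one_frameD(2)[OF fr] M]
    and EM = mult_carrier_mat[OF rank_one_frameD(5)[OF fr i] M]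
  have "mat_tr (E i * M) = (\<Sum>r<n. (E i * M) $$ (r, r))"
    unfolding mat_tr_def carrier_matD(1)[OF EM] ..
  also have "\<dots> = (\<Sum>r<n. (V * M) $$ (i, r) * U $$ (r, i))"
    by (intro sum.cong refl) (simp add: rank_one_frame_mult[OF fr M i] mult.commute)
  also have "\<dots> = (V * M * U) $$ (i, i)"
    by (rule index_mult_mat_sum[OF VM U i i, symmetric])
  finally show ?thesis .
qed

text \<open>The product is the scalar \<open>(V * M * U) $$ (i, j)\<close> times a column of
  \<open>U\<close> times a row of \<open>V\<close>, both non-zero by invertibility.\<close>

lemma rank_one_frame_zero_iff:
  assumes fr: "rank_one_frame n U V E" and M: "M \<in> carrier_mat n n"
    and i: "i < n" and j: "j < n"
  shows "E i * M * E j = 0\<^sub>m n n \<longleftrightarrow> (V * M * U) $$ (i, j) = 0"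
proof -
  note U = rank_one_frameD(1)[OF fr]
    and VM = mult_carrier_mat[OF rank_one_frameD(2)[OF fr] M]
    and EM = mult_carrier_mat[OF rank_one_frameD(5)[OF fr i] M]
    and Ej = rank_one_frameD(5)[OF fr j] and e = rank_one_frameD(6)[OF fr j]
  have entry: "(E i * M * E j) $$ (r, c) = U $$ (r, i) * (V * M * U) $$ (i, j) * V $$ (j, c)"
    if "r < n" "c < n" for r c
    unfolding index_mult_mat_sum[OF EM Ej that] index_mult_mat_sum[OF VM U i j]
      sum_distrib_left sum_distrib_right
    using that by (intro sum.cong refl) (simp add: rank_one_frame_mult[OF fr M i] e mult.assoc)
  have "\<exists>r<n. U $$ (r, i) \<noteq> 0"
  proof (rule ccontr)
    assume "\<not> ?thesis"
    hence "(\<Sum>l<n. V $$ (i, l) * U $$ (l, i)) = 0" by simp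
    thus False using rank_one_frame_sum(2)[OF fr i i] by simp
  qed
  then obtain r where r: "r < n" "U $$ (r, i) \<noteq> 0" by blast
  have "\<exists>c<n. V $$ (j, c) \<noteq> 0"
  proof (rule ccontr)
    assume "\<not> ?thesis"
    hence "(\<Sum>l<n. V $$ (j, l) * U $$ (l, j)) = 0" by simp
    thus False using rank_one_frame_sum(2)[OF fr j j] by simp
  qed
  then obtain c where c: "c < n" "V $$ (j, c) \<noteq> 0" by blast
  show ?thesis
  proof
    assume "E i * M * E j = 0\<^sub>m n n"
    hence "(E i * M * E j) $$ (r, c) = 0" using r c by simp
    thus "(V * M * U) $$ (i, j) = 0" using entry[OF r(1) c(1)] r c by simp
  next
    assume "(V * M * U) $$ (i, j) = 0"
    thus "E i * M * E j = 0\<^sub>m n n"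
      using entry EM Ej by (intro eq_matI) auto
  qed
qed

text \<open>Insert \<open>U * V\<close> after \<open>M\<close>, where \<open>M * U\<close> merely
  scales the columns of \<open>U\<close>.\<close>

lemma eigenbasis_expansion:
  assumes fr: "rank_one_frame n U V E" and M: "M \<in> carrier_mat n n"
    and ev: "\<And>r k. r < n \<Longrightarrow> k < n \<Longrightarrow> (M * U) $$ (r, k) = t k * U $$ (r, k)"
    and L: "L \<in> carrier_mat n n" and R: "R \<in> carrier_mat n n" and i: "i < n" and j: "j < n"
  shows "(L * M * R) $$ (i, j) = (\<Sum>k<n. (L * U) $$ (i, k) * t k * (V * R) $$ (k, j))"
proof -
  note U = rank_one_frameD(1)[OF fr] and V = rank_one_frameD(2)[OF fr]
    and UV = rank_one_frameD(3)[OF fr]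
  have "L * M * R = L * M * (U * V) * R" using L M by (simp add: UV)
  also have "\<dots> = (L * (M * U)) * (V * R)"
    using L M U V R by (simp add: assoc_mult_mat[where ?n\<^sub>1.0=n and ?n\<^sub>2.0=n and ?n\<^sub>3.0=n and ?n\<^sub>4.0=n])
  finally have "(L * M * R) $$ (i, j) = ((L * (M * U)) * (V * R)) $$ (i, j)" by simp
  also have "\<dots> = (\<Sum>k<n. (L * (M * U)) $$ (i, k) * (V * R) $$ (k, j))"
    using L M U V R i j by (intro index_mult_mat_sum[where n=n and k=n]) auto
  also have "\<dots> = (\<Sum>k<n. (L * U) $$ (i, k) * t k * (V * R) $$ (k, j))"
  proof (intro sum.cong refl)
    fix k assume "k \<in> {..<n}"
    hence k: "k < n" by simp
    have "(L * (M * U)) $$ (i, k) = (\<Sum>r<n. L $$ (i, r) * (M * U) $$ (r, k))"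
      using L M U i k by (intro index_mult_mat_sum[where n=n and k=n]) auto
    also have "\<dots> = (\<Sum>r<n. L $$ (i, r) * U $$ (r, k)) * t k"
      unfolding sum_distrib_right using k by (intro sum.cong refl) (simp add: ev)
    also have "\<dots> = (L * U) $$ (i, k) * t k"
      using index_mult_mat_sum[OF L U i k] by simp
    finally show "(L * (M * U)) $$ (i, k) * (V * R) $$ (k, j)
        = (L * U) $$ (i, k) * t k * (V * R) $$ (k, j)" by simp
  qed
  finally show ?thesis .
qed

text \<open>Factor each \<open>E i\<close> as column times row. The product rules say that row
  \<open>i\<close> times column \<open>j\<close> is the Kronecker delta, so rows and columns form
  inverse square matrices.\<close>

lemma orthogonal_idempotents_frame:
  fixes E :: "nat \<Rightarrow> 'a::field mat"
  assumes carrier: "\<And>i. i < n \<Longrightarrow> E i \<in> carrier_mat n n"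
    and orth: "\<And>i j. i < n \<Longrightarrow> j < n \<Longrightarrow> E i * E j = (if i = j then E i else 0\<^sub>m n n)"
    and rank: "\<And>i. i < n \<Longrightarrow> vec_space.rank n (E i) = 1"
  shows "\<exists>U V. rank_one_frame n U V E"
proof -
  have "\<forall>i<n. \<exists>u c. \<forall>r<n. \<forall>j<n. E i $$ (r, j) = u r * c j"
    using rank_one_factor[OF carrier rank] by blast
  then obtain u c where uc: "\<And>i r j. i < n \<Longrightarrow> r < n \<Longrightarrow> j < n \<Longrightarrow> E i $$ (r, j) = u i r * c i j"
    by metis
  define U where "U = mat n n (\<lambda>(r, i). u i r)"
  define V where "V = mat n n (\<lambda>(i, j). c i j)"
  have UV: "U \<in> carrier_mat n n" "V \<in> carrier_mat n n" by (auto simp: U_def V_def)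
  \<comment> \<open>Non-zero entries of both factors, which permit the cancellation in
    \<open>g\<close>.\<close>
  have nz: "\<exists>r<n. \<exists>j<n. u i r \<noteq> 0 \<and> c i j \<noteq> 0" if i: "i < n" for i
  proof (rule ccontr)
    assume "\<not> ?thesis"
    hence "E i = 0\<^sub>m n n" using uc[OF i] carrier[OF i] by (intro eq_matI) auto
    moreover have "vec_space.rank n (0\<^sub>m n n :: 'a mat) = 0" by (rule vec_space.rank_0I)
    ultimately show False using rank[OF i] by simp
  qed
  have g: "(\<Sum>l<n. c i l * u j l) = (if i = j then 1 else 0)" if ij: "i < n" "j < n" for i j
  proof -
    obtain r where r: "r < n" "u i r \<noteq> 0" using nz[OF ij(1)] by blast
    obtain k where k: "k < n" "c j k \<noteq> 0" using nz[OF ij(2)] by blast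
    have "(E i * E j) $$ (r, k) = (\<Sum>l<n. E i $$ (r, l) * E j $$ (l, k))"
      by (rule index_mult_mat_sum[OF carrier[OF ij(1)] carrier[OF ij(2)] r(1) k(1)])
    also have "\<dots> = u i r * (\<Sum>l<n. c i l * u j l) * c j k"
      unfolding sum_distrib_left sum_distrib_right
      using ij r k by (intro sum.cong refl) (simp add: uc mult.assoc)
    finally have "u i r * (\<Sum>l<n. c i l * u j l) * c j k = (if i = j then u i r * c j k else 0)"
      using orth[OF ij] uc[OF ij(1) r(1) k(1)] r k by (simp split: if_splits)
    thus ?thesis using r k by (simp split: if_splits)
  qed
  have "V * U = 1\<^sub>m n"
  proof (rule eq_matI)
    fix i j assume "i < dim_row (1\<^sub>m n)" "j < dim_col (1\<^sub>m n)"
    hence ij: "i < n" "j < n" by auto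
    have "(V * U) $$ (i, j) = (\<Sum>l<n. c i l * u j l)"
      unfolding index_mult_mat_sum[OF UV(2,1) ij] using ij
      by (intro sum.cong refl) (simp add: U_def V_def)
    thus "(V * U) $$ (i, j) = (1\<^sub>m n) $$ (i, j)" using g ij by simp
  qed (use UV in auto)
  moreover from this have "U * V = 1\<^sub>m n" by (rule mat_mult_left_right_inverse[OF UV(2,1)])
  ultimately have "rank_one_frame n U V E"
    unfolding rank_one_frame_def using UV carrier uc by (auto simp: U_def V_def)
  thus ?thesis by blast
qed

lemma mat_sum_list_carrier_index:
  fixes f :: "nat \<Rightarrow> 'a::comm_monoid_add mat"
  assumes "\<And>k. k \<in> set xs \<Longrightarrow> f k \<in> carrier_mat n n"
  shows "mat_sum_list n f xs \<in> carrier_mat n n"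
    and "r < n \<Longrightarrow> c < n \<Longrightarrow> mat_sum_list n f xs $$ (r, c) = (\<Sum>k\<leftarrow>xs. f k $$ (r, c))"
proof -
  have "mat_sum_list n f xs \<in> carrier_mat n n \<and>
    (\<forall>r<n. \<forall>c<n. mat_sum_list n f xs $$ (r, c) = (\<Sum>k\<leftarrow>xs. f k $$ (r, c)))"
    using assms
  proof (induction xs)
    case Nil
    show ?case by (simp add: mat_sum_list_def)
  next
    case (Cons x xs)
    hence "mat_sum_list n f xs \<in> carrier_mat n n \<and>
      (\<forall>r<n. \<forall>c<n. mat_sum_list n f xs $$ (r, c) = (\<Sum>k\<leftarrow>xs. f k $$ (r, c)))"
      and "f x \<in> carrier_mat n n" by auto
    moreover have "mat_sum_list n f (x # xs) = f x + mat_sum_list n f xs"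
      by (simp add: mat_sum_list_def)
    ultimately show ?case by auto
  qed
  thus "mat_sum_list n f xs \<in> carrier_mat n n"
    "r < n \<Longrightarrow> c < n \<Longrightarrow> mat_sum_list n f xs $$ (r, c) = (\<Sum>k\<leftarrow>xs. f k $$ (r, c))" by auto
qed

lemma rank_one_frame_mat_sum:
  fixes E :: "nat \<Rightarrow> 'a::field mat" and t :: "nat \<Rightarrow> 'a"
  assumes fr: "rank_one_frame n U V E"
  defines "M \<equiv> mat_sum_list n (\<lambda>k. t k \<cdot>\<^sub>m E k) [0..<n]"
  shows "M \<in> carrier_mat n n"
    and "r < n \<Longrightarrow> k < n \<Longrightarrow> (M * U) $$ (r, k) = t k * U $$ (r, k)"
proof -
  note U = rank_one_frameD(1)[OF fr]
  have E: "k \<in> set [0..<n] \<Longrightarrow> t k \<cdot>\<^sub>m E k \<in> carrier_mat n n" for k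
    using rank_one_frameD(5)[OF fr] by simp
  show M: "M \<in> carrier_mat n n"
    unfolding M_def by (rule mat_sum_list_carrier_index(1)[OF E])
  assume r: "r < n" and k: "k < n"
  have entry: "M $$ (r, c) = (\<Sum>l<n. (t l * U $$ (r, l)) * V $$ (l, c))" if c: "c < n" for c
  proof -
    have "M $$ (r, c) = (\<Sum>l\<leftarrow>[0..<n]. (t l \<cdot>\<^sub>m E l) $$ (r, c))"
      unfolding M_def by (rule mat_sum_list_carrier_index(2)[OF E r c])
    also have "\<dots> = (\<Sum>l<n. (t l \<cdot>\<^sub>m E l) $$ (r, c))"
      by (simp add: interv_sum_list_conv_sum_set_nat atLeast0LessThan)
    also have "\<dots> = (\<Sum>l<n. (t l * U $$ (r, l)) * V $$ (l, c))"
    proof (intro sum.cong refl)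
      fix l assume "l \<in> {..<n}"
      hence "E l \<in> carrier_mat n n" "E l $$ (r, c) = U $$ (r, l) * V $$ (l, c)"
        using rank_one_frameD(5,6)[OF fr] r c by simp_all
      thus "(t l \<cdot>\<^sub>m E l) $$ (r, c) = (t l * U $$ (r, l)) * V $$ (l, c)"
        using r c by (simp add: mult.assoc)
    qed
    finally show ?thesis .
  qed
  have "(M * U) $$ (r, k) = (\<Sum>c<n. M $$ (r, c) * U $$ (c, k))"
    by (rule index_mult_mat_sum[OF M U r k])
  also have "\<dots> = (\<Sum>c<n. \<Sum>l<n. (t l * U $$ (r, l)) * (V $$ (l, c) * U $$ (c, k)))"
    by (intro sum.cong refl) (simp add: entry sum_distrib_right mult.assoc)
  also have "\<dots> = (\<Sum>l<n. \<Sum>c<n. (t l * U $$ (r, l)) * (V $$ (l, c) * U $$ (c, k)))"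
    by (rule sum.swap)
  also have "\<dots> = (\<Sum>l<n. if l = k then t l * U $$ (r, l) else 0)"
    using k by (intro sum.cong refl)
      (simp add: sum_distrib_left[symmetric] rank_one_frame_sum(2)[OF fr])
  also have "\<dots> = t k * U $$ (r, k)" using k by simp
  finally show "(M * U) $$ (r, k) = t k * U $$ (r, k)" .
qed

section \<open>Primitive idempotents and eigenvectors\<close>

lemma prim_idem_carrier:
  assumes A: "A \<in> carrier_mat (Suc d) (Suc d)"
  shows "prim_idem d A \<theta> i \<in> carrier_mat (Suc d) (Suc d)"
proof -
  have "foldr (\<lambda>j M. ((1 / (\<theta> i - \<theta> j)) \<cdot>\<^sub>m (A - \<theta> j \<cdot>\<^sub>m 1\<^sub>m (Suc d))) * M) xs (1\<^sub>m (Suc d))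
      \<in> carrier_mat (Suc d) (Suc d)" for xs
    using A by (induction xs) auto
  thus ?thesis unfolding prim_idem_def .
qed

text \<open>Each factor scales \<open>w\<close> by
  \<open>(\<theta> j - \<theta> l) / (\<theta> i - \<theta> l)\<close>; the product is a Lagrange
  basis polynomial evaluated at \<open>\<theta> j\<close>.\<close>

lemma prim_idem_eigenvector:
  assumes A: "A \<in> carrier_mat (Suc d) (Suc d)" and inj: "inj_on \<theta> {0..d}"
    and w: "w \<in> carrier_vec (Suc d)" and Aw: "A *\<^sub>v w = \<theta> j \<cdot>\<^sub>v w" and i: "i \<le> d" and j: "j \<le> d"
  shows "prim_idem d A \<theta> i *\<^sub>v w = (if i = j then 1 else 0) \<cdot>\<^sub>v w"
proof -
  let ?n = "Suc d"
  define S where "S l = (1 / (\<theta> i - \<theta> l)) \<cdot>\<^sub>m (A - \<theta> l \<cdot>\<^sub>m 1\<^sub>m ?n)" for l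
  have S: "S l \<in> carrier_mat ?n ?n" for l using A by (auto simp: S_def)
  have Sw: "S l *\<^sub>v w = ((\<theta> j - \<theta> l) / (\<theta> i - \<theta> l)) \<cdot>\<^sub>v w" for l
  proof -
    have "(A - \<theta> l \<cdot>\<^sub>m 1\<^sub>m ?n) *\<^sub>v w = A *\<^sub>v w - (\<theta> l \<cdot>\<^sub>m 1\<^sub>m ?n) *\<^sub>v w"
      using A w by (intro minus_mult_distrib_mat_vec) auto
    also have "(\<theta> l \<cdot>\<^sub>m 1\<^sub>m ?n) *\<^sub>v w = \<theta> l \<cdot>\<^sub>v w"
      using w by (subst smult_mat_mult_vec[where n="?n" and m="?n"]) auto
    finally have "(A - \<theta> l \<cdot>\<^sub>m 1\<^sub>m ?n) *\<^sub>v w = (\<theta> j - \<theta> l) \<cdot>\<^sub>v w"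
      using w by (intro eq_vecI) (auto simp: Aw left_diff_distrib)
    moreover have "S l *\<^sub>v w = (1 / (\<theta> i - \<theta> l)) \<cdot>\<^sub>v ((A - \<theta> l \<cdot>\<^sub>m 1\<^sub>m ?n) *\<^sub>v w)"
      unfolding S_def using A w
      by (intro smult_mat_mult_vec[where n="?n" and m="?n"]) auto
    ultimately show ?thesis by (simp add: smult_smult_assoc)
  qed
  define G where "G xs = foldr (\<lambda>l M. S l * M) xs (1\<^sub>m ?n)" for xs
  have G: "G xs \<in> carrier_mat ?n ?n" for xs
  proof (induction xs)
    case (Cons l xs)
    thus ?case using mult_carrier_mat[OF S] by (simp add: G_def)
  qed (simp add: G_def)
  have Gw: "G xs *\<^sub>v w = (\<Prod>l\<leftarrow>xs. (\<theta> j - \<theta> l) / (\<theta> i - \<theta> l)) \<cdot>\<^sub>v w" for xs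
  proof (induction xs)
    case Nil
    show ?case using w by (simp add: G_def)
  next
    case (Cons l xs)
    let ?p = "\<Prod>l\<leftarrow>xs. (\<theta> j - \<theta> l) / (\<theta> i - \<theta> l)"
    have "G (l # xs) *\<^sub>v w = S l *\<^sub>v (G xs *\<^sub>v w)"
      using assoc_mult_mat_vec[OF S[of l] G[of xs] w] by (simp add: G_def)
    also have "\<dots> = ?p \<cdot>\<^sub>v (S l *\<^sub>v w)"
      unfolding Cons.IH by (rule mult_mat_vec[OF S w])
    finally show ?case by (simp add: Sw smult_smult_assoc mult.commute)
  qed
  have "(\<Prod>l\<leftarrow>filter (\<lambda>l. l \<noteq> i) [0..<?n]. (\<theta> j - \<theta> l) / (\<theta> i - \<theta> l)) = (if i = j then 1 else 0)"
  proof (cases "i = j")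
    case True
    have "(\<theta> j - \<theta> l) / (\<theta> i - \<theta> l) = 1" if "l \<in> set (filter (\<lambda>l. l \<noteq> i) [0..<?n])" for l
    proof -
      have "l \<le> d" "l \<noteq> i" using that by (simp_all only: set_filter set_upt) auto
      thus ?thesis using inj_onD[OF inj, of i l] i True by auto
    qed
    moreover have "prod_list (map f xs) = 1" if "\<And>l. l \<in> set xs \<Longrightarrow> f l = 1"
      for f :: "nat \<Rightarrow> 'a" and xs
      using that by (induction xs) auto
    ultimately show ?thesis using True by (simp only: if_True refl)
  next
    case False
    have "j \<in> set (filter (\<lambda>l. l \<noteq> i) [0..<?n])"
      using False j by (simp only: set_filter set_upt) auto
    from imageI[OF this, of "\<lambda>l. (\<theta> j - \<theta> l) / (\<theta> i - \<theta> l)"]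
    have "0 \<in> set (map (\<lambda>l. (\<theta> j - \<theta> l) / (\<theta> i - \<theta> l)) (filter (\<lambda>l. l \<noteq> i) [0..<?n]))"
      by (simp only: set_map diff_self div_0)
    thus ?thesis using False by (simp only: prod_list_zero_iff if_False)
  qed
  moreover have "prim_idem d A \<theta> i = G (filter (\<lambda>l. l \<noteq> i) [0..<?n])"
    by (simp add: prim_idem_def G_def S_def)
  ultimately show ?thesis by (simp only: Gw)
qed

text \<open>With eigenvectors as columns of \<open>W\<close>, the \<open>i\<close>-th idempotent
  keeps column \<open>i\<close> and kills the others. This gives both the invertibility of
  \<open>W\<close> and the factorisation through its inverse \<open>Z\<close>.\<close>

lemma prim_idem_frame:
  assumes A: "A \<in> carrier_mat (Suc d) (Suc d)" and inj: "inj_on \<theta> {0..d}"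
    and ev: "\<And>i. i \<le> d \<Longrightarrow> eigenvalue A (\<theta> i)"
  shows "\<exists>W Z. rank_one_frame (Suc d) W Z (prim_idem d A \<theta>) \<and>
    (\<forall>r<Suc d. \<forall>k<Suc d. (A * W) $$ (r, k) = \<theta> k * W $$ (r, k))"
proof -
  let ?n = "Suc d"
  let ?F = "prim_idem d A \<theta>"
  have "\<forall>i\<le>d. \<exists>w. eigenvector A w (\<theta> i)" using ev by (auto simp: eigenvalue_def)
  then obtain w where w: "\<And>i. i \<le> d \<Longrightarrow> eigenvector A (w i) (\<theta> i)" by metis
  have wc: "w i \<in> carrier_vec ?n" "w i \<noteq> 0\<^sub>v ?n" "A *\<^sub>v w i = \<theta> i \<cdot>\<^sub>v w i" if "i \<le> d" for i
    using w[OF that] A by (auto simp: eigenvector_def)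
  define W where "W = mat ?n ?n (\<lambda>(r, i). w i $ r)"
  have W: "W \<in> carrier_mat ?n ?n" by (simp add: W_def)
  have col: "col W k = w k" if "k \<le> d" for k
    using wc(1)[OF that] that by (intro eq_vecI) (auto simp: W_def)
  have F: "?F i \<in> carrier_mat ?n ?n" for i by (rule prim_idem_carrier[OF A])
  have MW: "(M * W) $$ (r, k) = (M *\<^sub>v w k) $ r" if "M \<in> carrier_mat ?n ?n" "r < ?n" "k < ?n" for M r k
    using that W col[of k] by simp
  have AW: "(A * W) $$ (r, k) = \<theta> k * W $$ (r, k)" if "r < ?n" "k < ?n" for r k
    using MW[OF A that] wc[of k] that by (simp add: W_def)
  have FW: "(?F i * W) $$ (r, k) = (if i = k then W $$ (r, k) else 0)"
    if "i < ?n" "r < ?n" "k < ?n" for i r k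
  proof -
    have "?F i *\<^sub>v w k = (if i = k then 1 else 0) \<cdot>\<^sub>v w k"
      using prim_idem_eigenvector[OF A inj wc(1,3)[of k]] that by simp
    thus ?thesis using MW[OF F that(2,3), of i] wc(1)[of k] that by (simp add: W_def)
  qed
  have "det W \<noteq> 0"
  proof
    assume "det W = 0"
    then obtain v where v: "v \<in> carrier_vec ?n" "v \<noteq> 0\<^sub>v ?n" "W *\<^sub>v v = 0\<^sub>v ?n"
      using det_0_iff_vec_prod_zero_field[OF W] by blast
    \<comment> \<open>Applying the \<open>i\<close>-th idempotent to a linear relation between the
      columns of \<open>W\<close> isolates its \<open>i\<close>-th term.\<close>
    have "v $ i = 0" if i: "i < ?n" for i
    proof -
      have "W $$ (r, i) * v $ i = 0" if r: "r < ?n" for r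
      proof -
        have "(?F i * W) *\<^sub>v v = ?F i *\<^sub>v 0\<^sub>v ?n"
          using assoc_mult_mat_vec[OF F W v(1)] v(3) by simp
        hence "((?F i * W) *\<^sub>v v) $ r = 0"
          using F[of i] r by (simp add: scalar_prod_def)
        moreover have "((?F i * W) *\<^sub>v v) $ r = (\<Sum>k<?n. (?F i * W) $$ (r, k) * v $ k)"
          using F[of i] W v(1) r by (intro index_mult_mat_vec_sum) auto
        moreover have "\<dots> = (\<Sum>k<?n. if i = k then W $$ (r, k) * v $ k else 0)"
          using i r by (intro sum.cong refl) (simp add: FW)
        moreover have "\<dots> = W $$ (r, i) * v $ i" using i by (simp del: sum.lessThan_Suc)
        ultimately show ?thesis by (simp only:)
      qed
      moreover obtain r where "r < ?n" "W $$ (r, i) \<noteq> 0"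
      proof (rule ccontr)
        assume "\<not> thesis"
        hence "\<And>r. r < ?n \<Longrightarrow> w i $ r = 0" using that i by (auto simp: W_def)
        hence "w i = 0\<^sub>v ?n" using wc(1)[of i] i by (intro eq_vecI) auto
        thus False using wc(2)[of i] i by simp
      qed
      ultimately show ?thesis by auto
    qed
    hence "v = 0\<^sub>v ?n" using v(1) by (intro eq_vecI) auto
    thus False using v(2) by simp
  qed
  from det_non_zero_imp_unit[OF W this, of "()"]
  obtain Z where Z: "Z \<in> carrier_mat ?n ?n" "W * Z = 1\<^sub>m ?n" "Z * W = 1\<^sub>m ?n"
    by (auto simp: Units_def ring_mat_simps)
  have "?F i $$ (r, c) = W $$ (r, i) * Z $$ (i, c)" if i: "i < ?n" and r: "r < ?n" and c: "c < ?n" for i r c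
  proof -
    have FWc: "?F i * W \<in> carrier_mat ?n ?n" by (rule mult_carrier_mat[OF F W])
    have "?F i = (?F i * W) * Z"
      using assoc_mult_mat[OF F[of i] W Z(1)] Z(2) F[of i] by simp
    hence "?F i $$ (r, c) = (\<Sum>k<?n. (?F i * W) $$ (r, k) * Z $$ (k, c))"
      using index_mult_mat_sum[OF FWc Z(1) r c] by simp
    also have "\<dots> = (\<Sum>k<?n. if i = k then W $$ (r, k) * Z $$ (k, c) else 0)"
      using i r by (intro sum.cong refl) (simp add: FW)
    finally show ?thesis using i by (simp del: sum.lessThan_Suc)
  qed
  hence "rank_one_frame ?n W Z ?F" using W Z F by (simp add: rank_one_frame_def)
  thus ?thesis using AW by blast
qed

section \<open>The characterization\<close>

lemma is_path_graph_cong: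
  assumes "\<And>i j. i \<le> d \<Longrightarrow> j \<le> d \<Longrightarrow> adj i j \<longleftrightarrow> adj' i j"
  shows "is_path_graph d adj \<longleftrightarrow> is_path_graph d adj'"
  unfolding is_path_graph_def using assms by simp

lemma has_leaf_cong:
  assumes "\<And>i j. i \<le> d \<Longrightarrow> j \<le> d \<Longrightarrow> adj i j \<longleftrightarrow> adj' i j"
  shows "has_leaf d adj \<longleftrightarrow> has_leaf d adj'"
proof -
  have "{w. w \<le> d \<and> adj v w} = {w. w \<le> d \<and> adj' v w}" if "v \<le> d" for v
    using assms that by blast
  thus ?thesis unfolding has_leaf_def by metis
qed

text \<open>\<open>V * W\<close> and \<open>Z * U\<close> are inverse transition matrices;
  \<open>eigenbasis_expansion\<close> is used once per frame, as \<open>W\<close> diagonalises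
  \<open>A\<close> and \<open>U\<close> diagonalises \<open>As\<close>.\<close>

lemma rank_one_frames_diag_pair:
  fixes A :: "'a::field mat"
  assumes UV: "rank_one_frame (Suc d) U V E" and WZ: "rank_one_frame (Suc d) W Z F"
    and A: "A \<in> carrier_mat (Suc d) (Suc d)" and As: "As \<in> carrier_mat (Suc d) (Suc d)"
    and AW: "\<And>r k. r < Suc d \<Longrightarrow> k < Suc d \<Longrightarrow> (A * W) $$ (r, k) = \<theta> k * W $$ (r, k)"
    and AsU: "\<And>r k. r < Suc d \<Longrightarrow> k < Suc d \<Longrightarrow> (As * U) $$ (r, k) = \<theta>s k * U $$ (r, k)"
  shows "diag_pair d (\<lambda>i k. (V * W) $$ (i, k)) (\<lambda>k j. (Z * U) $$ (k, j))
    (\<lambda>i j. (V * A * U) $$ (i, j)) (\<lambda>i j. (Z * As * W) $$ (i, j)) \<theta> \<theta>s"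
proof
  let ?n = "Suc d"
  note UV' = rank_one_frameD(1-4)[OF UV] and WZ' = rank_one_frameD(1-4)[OF WZ]
  note c = UV'(1,2) WZ'(1,2) mult_carrier_mat[OF UV'(2) WZ'(1)] mult_carrier_mat[OF WZ'(2) UV'(1)]
    and inv = UV'(3,4) WZ'(3,4)
  have prod: "(L * R) * (R' * L') = 1\<^sub>m ?n"
    if "L \<in> carrier_mat ?n ?n" "R \<in> carrier_mat ?n ?n" "R' \<in> carrier_mat ?n ?n" "L' \<in> carrier_mat ?n ?n"
      "R * R' = 1\<^sub>m ?n" "L * L' = 1\<^sub>m ?n" for L R R' L' :: "'a mat"
  proof -
    have "(L * R) * (R' * L') = L * (R * (R' * L'))"
      using that by (intro assoc_mult_mat) auto
    also have "R * (R' * L') = (R * R') * L'"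
      using that by (intro assoc_mult_mat[symmetric]) auto
    finally show ?thesis using that by simp
  qed
  fix i j assume "i \<le> d" "j \<le> d"
  hence ij: "i < ?n" "j < ?n" by auto
  have "(\<Sum>k<?n. (V * W) $$ (i, k) * (Z * U) $$ (k, j)) = (1\<^sub>m ?n) $$ (i, j)"
    unfolding index_mult_mat_sum[OF c(5,6) ij, symmetric] prod[OF c(2,3,4,1) inv(3,2)] ..
  thus "(\<Sum>k\<le>d. (V * W) $$ (i, k) * (Z * U) $$ (k, j)) = (if i = j then 1 else 0)"
    using ij by (simp only: lessThan_Suc_atMost index_one_mat)
  have "(\<Sum>k<?n. (Z * U) $$ (i, k) * (V * W) $$ (k, j)) = (1\<^sub>m ?n) $$ (i, j)"
    unfolding index_mult_mat_sum[OF c(6,5) ij, symmetric] prod[OF c(4,1,2,3) inv(1,4)] ..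
  thus "(\<Sum>k\<le>d. (Z * U) $$ (i, k) * (V * W) $$ (k, j)) = (if i = j then 1 else 0)"
    using ij by (simp only: lessThan_Suc_atMost index_one_mat)
  show "(V * A * U) $$ (i, j) = (\<Sum>k\<le>d. (V * W) $$ (i, k) * \<theta> k * (Z * U) $$ (k, j))"
    using eigenbasis_expansion[OF WZ A AW c(2,1) ij] by (simp only: lessThan_Suc_atMost)
  show "(Z * As * W) $$ (i, j) = (\<Sum>k\<le>d. (Z * U) $$ (i, k) * \<theta>s k * (V * W) $$ (k, j))"
    using eigenbasis_expansion[OF UV As AsU c(4,3) ij] by (simp only: lessThan_Suc_atMost)
qed

theorem theorem5p1:
  fixes d :: nat
    and Es :: "nat \<Rightarrow> 'a::field mat"
    and A :: "'a mat"
    and \<theta> \<theta>s :: "nat \<Rightarrow> 'a"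
  assumes d: "d \<ge> 1"
    and Es_carrier: "\<And>i. i \<le> d \<Longrightarrow> Es i \<in> carrier_mat (Suc d) (Suc d)"
    and Es_orth: "\<And>i j. i \<le> d \<Longrightarrow> j \<le> d \<Longrightarrow>
                    Es i * Es j = (if i = j then Es i else 0\<^sub>m (Suc d) (Suc d))"
    and Es_rank: "\<And>i. i \<le> d \<Longrightarrow> vec_space.rank (Suc d) (Es i) = 1"
    and A_carrier: "A \<in> carrier_mat (Suc d) (Suc d)"
    and A_far: "\<And>i j. i \<le> d \<Longrightarrow> j \<le> d \<Longrightarrow> i + 1 < j \<or> j + 1 < i \<Longrightarrow>
                   Es i * A * Es j = 0\<^sub>m (Suc d) (Suc d)"
    and A_near: "\<And>i j. i \<le> d \<Longrightarrow> j \<le> d \<Longrightarrow> i + 1 = j \<or> j + 1 = i \<Longrightarrow>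
                   Es i * A * Es j \<noteq> 0\<^sub>m (Suc d) (Suc d)"
    and \<theta>_distinct: "inj_on \<theta> {0..d}"
    and \<theta>_eig: "\<And>i. i \<le> d \<Longrightarrow> eigenvalue A (\<theta> i)"
  defines "a \<equiv> (\<lambda>i. mat_tr (Es i * A))"
    and "adj \<equiv> (\<lambda>i j. i \<noteq> j \<and> prim_idem d A \<theta> i * mat_sum_list (Suc d) (\<lambda>k. \<theta>s k \<cdot>\<^sub>m Es k) [0..<Suc d]
                                 * prim_idem d A \<theta> j \<noteq> 0\<^sub>m (Suc d) (Suc d))"
  shows "is_path_graph d adj \<longleftrightarrow>
     (has_leaf d adj
      \<and> (\<exists>\<beta> \<gamma>s.
           (\<forall>i. 1 \<le> i \<and> i \<le> d - 1 \<longrightarrow> \<gamma>s = \<theta>s (i - 1) - \<beta> * \<theta>s i + \<theta>s (i + 1))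
         \<and> (let prv = (\<lambda>i. if i = 0 then \<gamma>s + \<beta> * \<theta>s 0 - \<theta>s 1 else \<theta>s (i - 1));
                nxt = (\<lambda>i. if i = d then \<gamma>s + \<beta> * \<theta>s d - \<theta>s (d - 1) else \<theta>s (i + 1))
            in \<exists>\<gamma> \<omega> \<eta>s. \<forall>i\<le>d.
                 a i * (\<theta>s i - prv i) * (\<theta>s i - nxt i) = \<gamma> * (\<theta>s i)^2 + \<omega> * \<theta>s i + \<eta>s))
      \<and> (\<forall>i. 1 \<le> i \<and> i \<le> d \<longrightarrow> \<theta>s i \<noteq> \<theta>s 0))"
proof -
  let ?n = "Suc d"
  define As where "As = mat_sum_list ?n (\<lambda>k. \<theta>s k \<cdot>\<^sub>m Es k) [0..<?n]"
  obtain U V where UV: "rank_one_frame ?n U V Es"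
    using orthogonal_idempotents_frame[of ?n Es] Es_carrier Es_orth Es_rank by (auto simp: less_Suc_eq_le)
  obtain W Z where WZ: "rank_one_frame ?n W Z (prim_idem d A \<theta>)"
    and AW: "\<forall>r<?n. \<forall>k<?n. (A * W) $$ (r, k) = \<theta> k * W $$ (r, k)"
    using prim_idem_frame[OF A_carrier \<theta>_distinct \<theta>_eig] by blast
  have As: "As \<in> carrier_mat ?n ?n"
    unfolding As_def by (rule rank_one_frame_mat_sum(1)[OF UV])
  have AsU: "(As * U) $$ (r, k) = \<theta>s k * U $$ (r, k)" if "r < ?n" "k < ?n" for r k
    unfolding As_def by (rule rank_one_frame_mat_sum(2)[OF UV that])
  define B where "B = (\<lambda>i j. (V * A * U) $$ (i, j))"
  define T where "T = (\<lambda>i j. (Z * As * W) $$ (i, j))"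
  interpret diag_pair d "\<lambda>i k. (V * W) $$ (i, k)" "\<lambda>k j. (Z * U) $$ (k, j)" B T \<theta> \<theta>s
    unfolding B_def T_def using rank_one_frames_diag_pair[OF UV WZ A_carrier As] AW AsU by blast
  have tri: "tridiag d B"
    unfolding tridiag_def B_def
    using rank_one_frame_zero_iff[OF UV A_carrier] A_far A_near by (auto simp: less_Suc_eq_le)
  have a: "a i = B i i" if "i \<le> d" for i
    unfolding a_def B_def using rank_one_frame_trace[OF UV A_carrier, of i] that by simp
  have adj: "adj i j \<longleftrightarrow> i \<noteq> j \<and> T i j \<noteq> 0" if "i \<le> d" "j \<le> d" for i j
    unfolding adj_def T_def As_def[symmetric]
    using rank_one_frame_zero_iff[OF WZ As, of i j] that by simp
  have rec: "recurrent d \<theta>s \<beta> \<gamma>s \<longleftrightarrow>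
      (\<forall>i. 1 \<le> i \<and> i \<le> d - 1 \<longrightarrow> \<gamma>s = \<theta>s (i - 1) - \<beta> * \<theta>s i + \<theta>s (i + 1))" for \<beta> \<gamma>s
    unfolding recurrent_def using d by blast
  have quad: "B i i * (\<theta>s i - recurrent.prv \<theta>s \<beta> \<gamma>s i) * (\<theta>s i - recurrent.nxt d \<theta>s \<beta> \<gamma>s i)
      = a i * (\<theta>s i - (if i = 0 then \<gamma>s + \<beta> * \<theta>s 0 - \<theta>s 1 else \<theta>s (i - 1)))
          * (\<theta>s i - (if i = d then \<gamma>s + \<beta> * \<theta>s d - \<theta>s (d - 1) else \<theta>s (i + 1)))"
    if "recurrent d \<theta>s \<beta> \<gamma>s" "i \<le> d" for \<beta> \<gamma>s i
    by (simp only: a[OF that(2)] recurrent.prv_def[OF that(1)] recurrent.nxt_def[OF that(1)])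
  have path: "is_path_graph d adj \<longleftrightarrow> is_path_graph d (\<lambda>i j. i \<noteq> j \<and> T i j \<noteq> 0)"
    by (rule is_path_graph_cong) (rule adj)
  have leaf: "has_leaf d adj \<longleftrightarrow> has_leaf d (\<lambda>i j. i \<noteq> j \<and> T i j \<noteq> 0)"
    by (rule has_leaf_cong) (rule adj)
  show ?thesis
    unfolding path leaf path_iff[OF tri d] Let_def
  \<comment> \<open>\<open>conj_cong\<close> supplies the recurrence inside the second conjunct,
    where unfolding \<open>prv\<close> and \<open>nxt\<close> of the locale requires it.\<close>
  proof (rule conj_cong[OF refl], rule conj_cong[OF _ refl], intro ex_cong1 conj_cong rec)
    fix \<beta> \<gamma>s \<gamma> \<omega> \<eta>
    assume "\<forall>i. 1 \<le> i \<and> i \<le> d - 1 \<longrightarrow> \<gamma>s = \<theta>s (i - 1) - \<beta> * \<theta>s i + \<theta>s (i + 1)"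
    hence "recurrent d \<theta>s \<beta> \<gamma>s" by (simp only: rec)
    from quad[OF this]
    show "(\<forall>i\<le>d. B i i * (\<theta>s i - recurrent.prv \<theta>s \<beta> \<gamma>s i) * (\<theta>s i - recurrent.nxt d \<theta>s \<beta> \<gamma>s i)
          = \<gamma> * (\<theta>s i)^2 + \<omega> * \<theta>s i + \<eta>)
      \<longleftrightarrow> (\<forall>i\<le>d. a i * (\<theta>s i - (if i = 0 then \<gamma>s + \<beta> * \<theta>s 0 - \<theta>s 1 else \<theta>s (i - 1)))
          * (\<theta>s i - (if i = d then \<gamma>s + \<beta> * \<theta>s d - \<theta>s (d - 1) else \<theta>s (i + 1)))
          = \<gamma> * (\<theta>s i)^2 + \<omega> * \<theta>s i + \<eta>)"
      by auto
  qed
qed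

end
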